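(* Let $X\in\mathrm{Perf}$ and $T\in\mathrm{End}_{\mathrm{Perf}}(X)$. Then for any entire function $f$ there exists an endomorphism $f(T)\in\mathrm{End}_{\mathrm{Perf}}(X)$ such that, for every $i$, $H_i(f(T))$ is the linear map $f(H_i(T))$ obtained from classical functional calculus by applying $f$ to the induced map $H_i(T):H_i(X)\to H_i(X)$.
   Context: $\mathrm{Perf}$ denotes the stable $\infty$-category of perfect complexes of $\mathbb{C}$-vector spaces, i.e. the full subcategory of the derived $\infty$-category of $\mathbb{C}$-vector spaces on the bounded complexes with finite-dimensional homology. For a linear endomorphism $A$ of a finite-dimensional complex vector space and an entire function $f(z)=\sum_na_nz^n$, classical functional calculus gives $f(A)=\sum_na_nA^n$ (convergent in operator norm). *)

theory Defs
  imports "HOL-Complex_Analysis.Complex_Analysis" "HOL-Algebra.AbelCoset"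
    "Jordan_Normal_Form.VS_Connect"
begin

section \<open>Chain complexes of complex vector spaces and their homology\<close>

text \<open>
  Vector spaces are the carrier-based ones of the locale \<^locale>\<open>vectorspace\<close> over the field
  of complex numbers.  All terms of a complex live in one type of elements, which costs no
  generality: every family of vector spaces embeds into the disjoint union of its members.
  The multiplicative fields of the \<^typ>\<open>('a, 'v) module\<close> record carry no meaning.
\<close>

abbreviation CC :: "complex ring" where "CC \<equiv> class_ring"

definition quotient_space ::
  "(complex, 'v) module \<Rightarrow> 'v set \<Rightarrow> (complex, 'v set) module" where
  "quotient_space V W =
     \<lparr>carrier = a_rcosets\<^bsub>V\<^esub> W, mult = (\<lambda>_ _. W), one = W,
      zero = W, add = (\<lambda>S S'. S <+>\<^bsub>V\<^esub> S'),
      smult = (\<lambda>c S. \<Union>x\<in>S. W +>\<^bsub>V\<^esub> (c \<odot>\<^bsub>V\<^esub> x))\<rparr>"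

text \<open>Homological grading: the differential lowers the degree.\<close>

record 'v cpx =
  term_at :: "int \<Rightarrow> (complex, 'v) module"
  diff :: "int \<Rightarrow> 'v \<Rightarrow> 'v"

definition chain_complex :: "'v cpx \<Rightarrow> bool" where
  "chain_complex X \<longleftrightarrow>
     (\<forall>i. linear_map CC (term_at X i) (term_at X (i - 1)) (diff X i)) \<and>
     (\<forall>i. \<forall>x\<in>carrier (term_at X i).
        diff X (i - 1) (diff X i x) = \<zero>\<^bsub>term_at X (i - 2)\<^esub>)"

definition bounded_complex :: "'v cpx \<Rightarrow> bool" where
  "bounded_complex X \<longleftrightarrow>
     (\<exists>b. \<forall>i. b < \<bar>i\<bar> \<longrightarrow> carrier (term_at X i) = {\<zero>\<^bsub>term_at X i\<^esub>})"

definition cycles :: "'v cpx \<Rightarrow> int \<Rightarrow> 'v set" where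
  "cycles X i = {x \<in> carrier (term_at X i). diff X i x = \<zero>\<^bsub>term_at X (i - 1)\<^esub>}"

definition boundaries :: "'v cpx \<Rightarrow> int \<Rightarrow> 'v set" where
  "boundaries X i = diff X (i + 1) ` carrier (term_at X (i + 1))"

definition homology :: "int \<Rightarrow> 'v cpx \<Rightarrow> (complex, 'v set) module" where
  "homology i X =
     quotient_space (term_at X i\<lparr>carrier := cycles X i\<rparr>) (boundaries X i)"

text \<open>The map induced on homology by a chain map \<open>\<phi>\<close> into \<open>Y\<close>.\<close>

definition homology_map :: "int \<Rightarrow> 'v cpx \<Rightarrow> (int \<Rightarrow> 'v \<Rightarrow> 'v) \<Rightarrow> 'v set \<Rightarrow> 'v set" where
  "homology_map i Y \<phi> = (\<lambda>S. \<Union>x\<in>S. boundaries Y i +>\<^bsub>term_at Y i\<^esub> \<phi> i x)"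


section \<open>Simplicial sets\<close>

text \<open>
  \<open>simplices S n\<close> is the set of \<open>n\<close>-simplices; for a monotone \<open>\<alpha> : [m] \<rightarrow> [n]\<close> the operator
  \<open>act S m \<alpha>\<close> is \<open>\<alpha>\<^sup>*\<close>, from \<open>n\<close>-simplices to \<open>m\<close>-simplices.
\<close>

record 's sset =
  simplices :: "nat \<Rightarrow> 's set"
  act :: "nat \<Rightarrow> (nat \<Rightarrow> nat) \<Rightarrow> 's \<Rightarrow> 's"

definition vertex :: "'s sset \<Rightarrow> nat \<Rightarrow> 's \<Rightarrow> 's" where
  "vertex S i \<sigma> = act S 0 (\<lambda>_. i) \<sigma>"

definition full_subcategory :: "'s sset \<Rightarrow> 's set \<Rightarrow> 's sset" where
  "full_subcategory S P =
     S\<lparr>simplices := (\<lambda>n. {\<sigma> \<in> simplices S n. \<forall>i\<le>n. vertex S i \<sigma> \<in> P})\<rparr>"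

text \<open>An endomorphism of \<open>x\<close> is a point of the mapping space from \<open>x\<close> to \<open>x\<close>, that is an edge
  with both end points \<open>x\<close>.\<close>

definition End :: "'s sset \<Rightarrow> 's \<Rightarrow> 's set" where
  "End S x = {e \<in> simplices S 1. vertex S 0 e = x \<and> vertex S 1 e = x}"


section \<open>The derived infinity-category of complex vector spaces\<close>

text \<open>
  Over a field every complex is both fibrant and cofibrant, so the derived infinity-category is
  the differential graded nerve (Lurie, Higher Algebra, 1.3.1.6) of the dg category of all
  chain complexes.  An element of degree \<open>p\<close> of the mapping complex is a family of linear maps
  raising the degree by \<open>p\<close>.  Requiring extensionality makes equality of simplices the intended one.
\<close>

definition Hom_deg :: "'v cpx \<Rightarrow> 'v cpx \<Rightarrow> int \<Rightarrow> (int \<Rightarrow> 'v \<Rightarrow> 'v) set" where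
  "Hom_deg X Y p =
     {f. \<forall>k. linear_map CC (term_at X k) (term_at Y (k + p)) (f k) \<and>
             f k \<in> extensional (carrier (term_at X k))}"

text \<open>
  An \<open>n\<close>-simplex consists of complexes \<open>X\<^sub>0, \<dots>, X\<^sub>n\<close> and, for every
  \<open>I = {i\<^sub>- < i\<^sub>m < \<dots> < i\<^sub>1 < i\<^sub>+} \<subseteq> [n]\<close>, an element \<open>f\<^sub>I\<close> of degree \<open>m\<close> of the mapping complex
  from \<open>X\<close> at \<open>i\<^sub>-\<close> to \<open>X\<close> at \<open>i\<^sub>+\<close>, such that \<open>d f\<^sub>I\<close> is the sum over \<open>1 \<le> j \<le> m\<close> of
  \<open>(-1)\<^sup>j (f\<^bsub>I - {i\<^sub>j}\<^esub> - f\<^bsub>{i\<^sub>j < \<dots> < i\<^sub>1 < i\<^sub>+}\<^esub> \<circ> f\<^bsub>{i\<^sub>- < i\<^sub>m < \<dots> < i\<^sub>j}\<^esub>)\<close>,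
  where \<open>d f = d \<circ> f - (-1)\<^sup>m f \<circ> d\<close>.
  Below the bound variable \<open>j\<close> is the index \<open>i\<^sub>j\<close> itself, and the exponent \<open>j\<close>
  is the number of elements of \<open>I\<close> above it.
\<close>

type_synonym 'v dg_simplex = "(nat \<Rightarrow> 'v cpx) \<times> (nat set \<Rightarrow> int \<Rightarrow> 'v \<Rightarrow> 'v)"

definition nerve_index :: "nat \<Rightarrow> nat set set" where
  "nerve_index n = {I. I \<subseteq> {..n} \<and> 2 \<le> card I}"

definition fdeg :: "nat set \<Rightarrow> int" where
  "fdeg I = int (card I) - 2"

definition dg_coherent :: "(nat \<Rightarrow> 'v cpx) \<Rightarrow> (nat set \<Rightarrow> int \<Rightarrow> 'v \<Rightarrow> 'v) \<Rightarrow> nat set \<Rightarrow> bool" where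
  "dg_coherent X f I \<longleftrightarrow>
     (\<forall>k. \<forall>x\<in>carrier (term_at (X (Min I)) k).
        let V = term_at (X (Max I)) (k + fdeg I - 1) in
        diff (X (Max I)) (k + fdeg I) (f I k x)
          \<ominus>\<^bsub>V\<^esub> (((- 1) ^ card I) \<odot>\<^bsub>V\<^esub> f I (k - 1) (diff (X (Min I)) k x))
        = (\<Oplus>\<^bsub>V\<^esub>j\<in>I - {Min I, Max I}.
             ((- 1) ^ card {l \<in> I. j < l}) \<odot>\<^bsub>V\<^esub>
               (f (I - {j}) k x
                 \<ominus>\<^bsub>V\<^esub> f {l \<in> I. j \<le> l} (k + fdeg {l \<in> I. l \<le> j}) (f {l \<in> I. l \<le> j} k x))))"

definition dg_simplices :: "nat \<Rightarrow> 'v dg_simplex set" where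
  "dg_simplices n =
     {(X, f). X \<in> {..n} \<rightarrow>\<^sub>E Collect chain_complex \<and>
              f \<in> (\<Pi>\<^sub>E I\<in>nerve_index n. Hom_deg (X (Min I)) (X (Max I)) (fdeg I)) \<and>
              (\<forall>I\<in>nerve_index n. dg_coherent X f I)}"

definition dg_act :: "nat \<Rightarrow> (nat \<Rightarrow> nat) \<Rightarrow> 'v dg_simplex \<Rightarrow> 'v dg_simplex" where
  "dg_act m \<alpha> = (\<lambda>(X, f).
     (\<lambda>i\<in>{..m}. X (\<alpha> i),
      \<lambda>J\<in>nerve_index m.
        if inj_on \<alpha> J then f (\<alpha> ` J)
        else if card J = 2 then (\<lambda>k. \<lambda>x\<in>carrier (term_at (X (\<alpha> (Min J))) k). x)
        else (\<lambda>k. \<lambda>x\<in>carrier (term_at (X (\<alpha> (Min J))) k). \<zero>\<^bsub>term_at (X (\<alpha> (Max J))) (k + fdeg J)\<^esub>)))"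

definition derived_category :: "'v dg_simplex sset" where
  "derived_category = \<lparr>simplices = dg_simplices, act = dg_act\<rparr>"

abbreviation complex_of :: "'v dg_simplex \<Rightarrow> 'v cpx" where
  "complex_of x \<equiv> fst x 0"

definition Perf :: "'v dg_simplex sset" where
  "Perf = full_subcategory derived_category
     {x \<in> simplices derived_category 0.
        bounded_complex (complex_of x) \<and>
        (\<forall>i. vectorspace.fin_dim CC (homology i (complex_of x)))}"

text \<open>Homology on objects and on edges.\<close>

definition H_obj :: "int \<Rightarrow> 'v dg_simplex \<Rightarrow> (complex, 'v set) module" where
  "H_obj i x = homology i (complex_of x)"

definition H_map :: "int \<Rightarrow> 'v dg_simplex \<Rightarrow> 'v set \<Rightarrow> 'v set" where
  "H_map i e = homology_map i (fst e 1) (snd e {0, 1})"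


section \<open>Classical functional calculus\<close>

definition vs_norm :: "(complex, 'w) module \<Rightarrow> ('w \<Rightarrow> real) \<Rightarrow> bool" where
  "vs_norm V N \<longleftrightarrow>
     (\<forall>v\<in>carrier V. 0 \<le> N v \<and> (N v = 0 \<longleftrightarrow> v = \<zero>\<^bsub>V\<^esub>)) \<and>
     (\<forall>v\<in>carrier V. \<forall>w\<in>carrier V. N (v \<oplus>\<^bsub>V\<^esub> w) \<le> N v + N w) \<and>
     (\<forall>c. \<forall>v\<in>carrier V. N (c \<odot>\<^bsub>V\<^esub> v) = cmod c * N v)"

definition operator_norm :: "(complex, 'w) module \<Rightarrow> ('w \<Rightarrow> real) \<Rightarrow> ('w \<Rightarrow> 'w) \<Rightarrow> real" where
  "operator_norm V N A = (SUP v\<in>{v \<in> carrier V. N v \<le> 1}. N (A v))"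

definition taylor_coeff :: "(complex \<Rightarrow> complex) \<Rightarrow> nat \<Rightarrow> complex" where
  "taylor_coeff f n = (deriv ^^ n) f 0 / fact n"

text \<open>
  \<open>functional_calculus V f A B\<close> says that \<open>B = f(A)\<close>: the series \<open>\<Sum>n. a\<^sub>n A\<^sup>n\<close> converges to \<open>B\<close> in
  operator norm.  It is used for finite-dimensional \<open>V\<close> only, where all norms are equivalent, so that
  no norm has to be singled out; a norm exists by \<open>ex_vs_norm\<close> below.
\<close>

definition functional_calculus ::
  "(complex, 'w) module \<Rightarrow> (complex \<Rightarrow> complex) \<Rightarrow> ('w \<Rightarrow> 'w) \<Rightarrow> ('w \<Rightarrow> 'w) \<Rightarrow> bool" where
  "functional_calculus V f A B \<longleftrightarrow>
     linear_map CC V V B \<and>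
     (\<forall>N. vs_norm V N \<longrightarrow>
        (\<lambda>n. operator_norm V N
               (\<lambda>v. (\<Oplus>\<^bsub>V\<^esub>k\<in>{..<n}. taylor_coeff f k \<odot>\<^bsub>V\<^esub> (A ^^ k) v) \<ominus>\<^bsub>V\<^esub> B v))
        \<longlonglongrightarrow> 0)"


section \<open>Basic facts\<close>


lemma quotient_space_vectorspace:
  assumes V: "vectorspace CC V" and W: "submodule CC W V"
  shows "vectorspace CC (quotient_space V W)"
proof -
  interpret V: vectorspace CC V by (rule V)
  interpret W: submodule CC W V by (rule W)
  have sub: "abelian_subgroup W V"
  proof (rule abelian_subgroupI3)
    show "additive_subgroup W V"
    proof (rule additive_subgroup.intro, unfold_locales)
      show "W \<subseteq> carrier (add_monoid V)" using W.subset by simp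
      show "\<And>x y. x \<in> W \<Longrightarrow> y \<in> W \<Longrightarrow> x \<otimes>\<^bsub>add_monoid V\<^esub> y \<in> W" by simp
      show "\<one>\<^bsub>add_monoid V\<^esub> \<in> W" by simp
      fix x assume x: "x \<in> W"
      have xc: "x \<in> carrier V" using x W.subset by auto
      have "\<ominus>\<^bsub>V\<^esub> x \<in> W"
        using W.smult_closed[of "\<ominus>\<^bsub>CC\<^esub> \<one>\<^bsub>CC\<^esub>", OF _ x] V.smult_minus_1[OF xc]
        by simp
      then show "inv\<^bsub>add_monoid V\<^esub> x \<in> W" by (simp add: a_inv_def)
    qed
    show "abelian_group V" by unfold_locales
  qed
  interpret S: abelian_subgroup W V by (rule sub)
  note Wc = W.subset
  have car: "carrier (quotient_space V W) = {W +>\<^bsub>V\<^esub> x | x. x \<in> carrier V}"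
    unfolding quotient_space_def A_RCOSETS_def' by auto
  have add: "(W +>\<^bsub>V\<^esub> x) <+>\<^bsub>V\<^esub> (W +>\<^bsub>V\<^esub> y) = W +>\<^bsub>V\<^esub> (x \<oplus>\<^bsub>V\<^esub> y)"
    if "x \<in> carrier V" "y \<in> carrier V" for x y
    using S.a_rcos_sum[OF that] .
  have smu: "(\<Union>z\<in>W +>\<^bsub>V\<^esub> x. W +>\<^bsub>V\<^esub> (c \<odot>\<^bsub>V\<^esub> z)) = W +>\<^bsub>V\<^esub> (c \<odot>\<^bsub>V\<^esub> x)"
    if x: "x \<in> carrier V" for c x
  proof -
    have "W +>\<^bsub>V\<^esub> (c \<odot>\<^bsub>V\<^esub> z) = W +>\<^bsub>V\<^esub> (c \<odot>\<^bsub>V\<^esub> x)" if z: "z \<in> W +>\<^bsub>V\<^esub> x" for z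
    proof -
      obtain w where w: "w \<in> W" "z = w \<oplus>\<^bsub>V\<^esub> x" using z unfolding a_r_coset_def' by auto
      have wc: "w \<in> carrier V" using w Wc by auto
      have "c \<odot>\<^bsub>V\<^esub> z = c \<odot>\<^bsub>V\<^esub> w \<oplus>\<^bsub>V\<^esub> c \<odot>\<^bsub>V\<^esub> x"
        using V.smult_r_distr[of c w x] wc x w by simp
      then have "c \<odot>\<^bsub>V\<^esub> z \<in> W +>\<^bsub>V\<^esub> (c \<odot>\<^bsub>V\<^esub> x)"
        using W.smult_closed[of c w] w unfolding a_r_coset_def' by auto
      then show ?thesis using S.a_repr_independence' V.smult_closed x by simp
    qed
    moreover have "x \<in> W +>\<^bsub>V\<^esub> x" using S.a_rcos_self x by blast
    ultimately show ?thesis by blast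
  qed
  have zW: "W +>\<^bsub>V\<^esub> \<zero>\<^bsub>V\<^esub> = W"
    using Wc unfolding a_r_coset_def' by force
  have q: "carrier (quotient_space V W) = {W +>\<^bsub>V\<^esub> x | x. x \<in> carrier V}"
     "\<zero>\<^bsub>quotient_space V W\<^esub> = W +>\<^bsub>V\<^esub> \<zero>\<^bsub>V\<^esub>"
     "\<And>x y. x \<in> carrier V \<Longrightarrow> y \<in> carrier V \<Longrightarrow>
        (W +>\<^bsub>V\<^esub> x) \<oplus>\<^bsub>quotient_space V W\<^esub> (W +>\<^bsub>V\<^esub> y) = W +>\<^bsub>V\<^esub> (x \<oplus>\<^bsub>V\<^esub> y)"
     "\<And>c x. x \<in> carrier V \<Longrightarrow>
        c \<odot>\<^bsub>quotient_space V W\<^esub> (W +>\<^bsub>V\<^esub> x) = W +>\<^bsub>V\<^esub> (c \<odot>\<^bsub>V\<^esub> x)"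
    using car add smu zW by (auto simp: quotient_space_def)
  have ag: "abelian_group (quotient_space V W)"
  proof (rule abelian_groupI)
    fix x assume "x \<in> carrier (quotient_space V W)"
    then obtain a where a: "a \<in> carrier V" "x = W +>\<^bsub>V\<^esub> a" using q(1) by auto
    show "\<exists>y\<in>carrier (quotient_space V W). y \<oplus>\<^bsub>quotient_space V W\<^esub> x = \<zero>\<^bsub>quotient_space V W\<^esub>"
      by (rule bexI[of _ "W +>\<^bsub>V\<^esub> (\<ominus>\<^bsub>V\<^esub> a)"]) (use a q in \<open>auto simp: V.l_neg\<close>)
  next
    fix x y assume "x \<in> carrier (quotient_space V W)" "y \<in> carrier (quotient_space V W)"
    then show "x \<oplus>\<^bsub>quotient_space V W\<^esub> y \<in> carrier (quotient_space V W)"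
      using q by (fastforce intro: V.a_closed)
  next
    show "\<zero>\<^bsub>quotient_space V W\<^esub> \<in> carrier (quotient_space V W)"
      using q by auto
  qed (auto simp: q V.a_ac)
  have "module CC (quotient_space V W)"
  proof (rule module.intro)
    show "cring CC" using V.module_axioms by (rule module.axioms) 
    show "abelian_group (quotient_space V W)" by (rule ag)
    show "module_axioms CC (quotient_space V W)"
      by unfold_locales
        (use V.smult_closed V.smult_l_distr V.smult_r_distr V.smult_assoc1 V.smult_one in
          \<open>auto simp: q\<close>)
  qed
  then show ?thesis using V by (simp add: vectorspace_def)
qed

lemma homology_vectorspace:
  assumes X: "chain_complex X"
  shows "vectorspace CC (homology i X)"
proof -
  interpret d: linear_map CC "term_at X i" "term_at X (i - 1)" "diff X i"
    using X unfolding chain_complex_def by blast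
  have 1: "i + 1 - 1 = i" by simp
  interpret e: linear_map CC "term_at X (i + 1)" "term_at X i" "diff X (i + 1)"
    using X unfolding chain_complex_def by (metis 1)
  have ker: "cycles X i = d.ker" unfolding cycles_def d.ker_def by simp
  have im: "boundaries X i = e.im" unfolding boundaries_def e.im_def by simp
  have dd: "boundaries X i \<subseteq> cycles X i"
  proof
    fix y assume "y \<in> boundaries X i"
    then obtain x where x: "x \<in> carrier (term_at X (i + 1))" "y = diff X (i + 1) x"
      unfolding boundaries_def by auto
    have "diff X (i + 1 - 1) (diff X (i + 1) x) = \<zero>\<^bsub>term_at X (i + 1 - 2)\<^esub>"
      using X x unfolding chain_complex_def by blast
    then show "y \<in> cycles X i" using x e.f_im unfolding cycles_def by (auto simp: e.im_def)
  qed
  have V: "vectorspace CC (term_at X i\<lparr>carrier := cycles X i\<rparr>)"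
    unfolding ker by (rule d.V.subspace_is_vs, rule d.kerT_is_subspace)
  interpret Z: vectorspace CC "term_at X i\<lparr>carrier := cycles X i\<rparr>" by (rule V)
  interpret B: submodule CC "boundaries X i" "term_at X i"
    unfolding im by (rule e.im_is_submodule)
  have "submodule CC (boundaries X i) (term_at X i\<lparr>carrier := cycles X i\<rparr>)"
    using dd Z.module_axioms by unfold_locales auto
  then show ?thesis unfolding homology_def using quotient_space_vectorspace V by blast
qed

lemma ex_vs_norm:
  assumes V: "vectorspace CC V" and fd: "vectorspace.fin_dim CC V"
  shows "\<exists>N. vs_norm V N"
proof -
  interpret V: vectorspace CC V by (rule V)
  obtain B where B: "finite B" "V.basis B" using V.finite_basis_exists fd by blast
  have Bc: "B \<subseteq> carrier V" using B unfolding V.basis_def by blast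
  define P where "P v a \<longleftrightarrow> a \<in> B \<rightarrow>\<^sub>E UNIV \<and> V.lincomb a B = v" for v and a :: "_ \<Rightarrow> complex"
  have ex1: "v \<in> carrier V \<Longrightarrow> \<exists>!a. P v a" for v
    using V.basis_criterion[OF B(1) Bc] B(2) unfolding P_def by simp
  define co where "co v = (THE a. P v a)" for v
  have co: "P v (co v)" if "v \<in> carrier V" for v
    unfolding co_def using theI'[of "P v"] ex1[OF that] by blast
  have coI: "co v = a" if "P v a" for v a
  proof -
    have "v \<in> carrier V" using that Bc unfolding P_def by auto
    then show ?thesis using ex1 co that by blast
  qed
  have co_add: "co (v \<oplus>\<^bsub>V\<^esub> w) = (\<lambda>b\<in>B. co v b + co w b)"
    if "v \<in> carrier V" "w \<in> carrier V" for v w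
  proof (rule coI)
    have "V.lincomb (\<lambda>b\<in>B. co v b + co w b) B = V.lincomb (\<lambda>b. co v b + co w b) B"
      by (rule V.lincomb_cong) (use Bc in auto)
    also have "\<dots> = v \<oplus>\<^bsub>V\<^esub> w"
      using V.lincomb_sum[OF B(1) Bc, of "co v" "co w"] co[OF that(1)] co[OF that(2)]
      unfolding P_def by simp
    finally show "P (v \<oplus>\<^bsub>V\<^esub> w) (\<lambda>b\<in>B. co v b + co w b)" unfolding P_def by auto
  qed
  have co_sm: "co (c \<odot>\<^bsub>V\<^esub> v) = (\<lambda>b\<in>B. c * co v b)" if "v \<in> carrier V" for c v
  proof (rule coI)
    have "V.lincomb (\<lambda>b\<in>B. c * co v b) B = V.lincomb (\<lambda>b. c * co v b) B"
      by (rule V.lincomb_cong) (use Bc in auto)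
    also have "\<dots> = c \<odot>\<^bsub>V\<^esub> v"
      using V.lincomb_smult[OF Bc, of "co v" c] co[OF that] unfolding P_def by simp
    finally show "P (c \<odot>\<^bsub>V\<^esub> v) (\<lambda>b\<in>B. c * co v b)" unfolding P_def by auto
  qed
  define N where "N v = (\<Sum>b\<in>B. cmod (co v b))" for v
  have N0: "N v = 0 \<longleftrightarrow> v = \<zero>\<^bsub>V\<^esub>" if v: "v \<in> carrier V" for v
  proof
    assume "N v = 0"
    then have z: "\<forall>b\<in>B. co v b = 0"
      unfolding N_def using B(1) by (subst (asm) sum_nonneg_eq_0_iff) auto
    have "co (0 \<odot>\<^bsub>V\<^esub> v) = co v"
      unfolding co_sm[OF v] using z co[OF v] unfolding P_def by (auto simp: fun_eq_iff PiE_def extensional_def)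
    then have "0 \<odot>\<^bsub>V\<^esub> v = v" 
      using co[OF v] co[of "0 \<odot>\<^bsub>V\<^esub> v"] V.smult_closed[of 0 v] v unfolding P_def by simp
    then show "v = \<zero>\<^bsub>V\<^esub>" using V.lmult_0[OF v] by simp
  next
    assume "v = \<zero>\<^bsub>V\<^esub>"
    then have "v = 0 \<odot>\<^bsub>V\<^esub> v" using V.lmult_0[OF v] by simp
    then have "co v = (\<lambda>b\<in>B. 0 * co v b)" using co_sm[OF v, of 0] by simp
    then have "\<forall>b\<in>B. co v b = 0" by (metis mult_zero_left restrict_apply')
    then show "N v = 0" unfolding N_def by simp
  qed
  have "vs_norm V N" unfolding vs_norm_def
  proof (intro conjI ballI allI)
    fix v w assume v: "v \<in> carrier V" and w: "w \<in> carrier V"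
    show "0 \<le> N v" unfolding N_def by (simp add: sum_nonneg)
    show "N v = 0 \<longleftrightarrow> v = \<zero>\<^bsub>V\<^esub>" by (rule N0[OF v])
    show "N (v \<oplus>\<^bsub>V\<^esub> w) \<le> N v + N w"
      unfolding N_def co_add[OF v w] sum.distrib[symmetric]
      by (intro sum_mono) (simp add: norm_triangle_ineq)
    fix c show "N (c \<odot>\<^bsub>V\<^esub> v) = cmod c * N v"
      unfolding N_def co_sm[OF v] sum_distrib_left
      by (intro sum.cong refl) (simp add: norm_mult)
  qed
  then show ?thesis by blast
qed

lemma nerve_index_1: "nerve_index 1 = {{0, 1}}"
proof
  show "nerve_index 1 \<subseteq> {{0, 1}}"
  proof
    fix I assume I: "I \<in> nerve_index 1"
    have 1: "{..1::nat} = {0, 1}" by auto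
    then have "I \<subseteq> {0, 1}" "card {0, 1::nat} \<le> card I" using I unfolding nerve_index_def by auto
    then have "I = {0, 1}" by (intro card_seteq) auto
    then show "I \<in> {{0, 1}}" by simp
  qed
qed (auto simp: nerve_index_def)

lemma nerve_index_0: "nerve_index 0 = {}"
proof -
  have "card I < 2" if "I \<subseteq> {0::nat}" for I
    using card_mono[OF _ that] by simp
  then show ?thesis unfolding nerve_index_def by (force simp: not_le)
qed

text \<open>Endomorphisms in \<^const>\<open>Perf\<close> are exactly the chain maps.\<close>

lemma End_Perf_iff:
  fixes X T :: "'v dg_simplex"
  assumes X: "X \<in> simplices Perf 0"
  defines "C \<equiv> complex_of X"
  shows "T \<in> End Perf X \<longleftrightarrow>
    (\<exists>\<phi>. T = (\<lambda>i\<in>{..1}. C, \<lambda>I\<in>{{0, 1}}. \<phi>) \<and>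
       (\<forall>k. linear_map CC (term_at C k) (term_at C k) (\<phi> k) \<and>
            \<phi> k \<in> extensional (carrier (term_at C k))) \<and>
       (\<forall>k. \<forall>x\<in>carrier (term_at C k). diff C k (\<phi> k x) = \<phi> (k - 1) (diff C k x)))"
    (is "_ \<longleftrightarrow> (\<exists>\<phi>. ?R \<phi>)")
proof -
  have X': "chain_complex C" "X = (\<lambda>i\<in>{..0}. C, \<lambda>I\<in>{}. undefined)"
    using X unfolding Perf_def full_subcategory_def derived_category_def dg_simplices_def C_def
    by (auto simp: nerve_index_0 PiE_def Pi_def extensional_def fun_eq_iff)
  have vx: "vertex derived_category i (Y, f) = (\<lambda>j\<in>{..0}. Y i, \<lambda>I\<in>{}. undefined)" for i and Y :: "nat \<Rightarrow> 'v cpx" and f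
    unfolding vertex_def derived_category_def by (simp add: dg_act_def nerve_index_0 restrict_def)
  have vP: "vertex Perf i e = vertex derived_category i e" for i and e :: "'v dg_simplex"
    unfolding Perf_def full_subcategory_def vertex_def by simp
  have vX: "vertex derived_category 0 X = X"
    by (subst (1 2) X'(2)) (simp add: vx)
  have XP: "X \<in> {x \<in> simplices derived_category 0.
        bounded_complex (complex_of x) \<and>
        (\<forall>i. vectorspace.fin_dim CC (homology i (complex_of x)))}"
    using X vX unfolding Perf_def full_subcategory_def by auto
  have E: "T \<in> End Perf X \<longleftrightarrow> T \<in> dg_simplices 1 \<and>
             vertex derived_category 0 T = X \<and> vertex derived_category 1 T = X"
  proof -
    have "(\<forall>i\<le>1. vertex derived_category i T = X) \<longleftrightarrow>
          vertex derived_category 0 T = X \<and> vertex derived_category 1 T = X"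
      using le_Suc_eq[of _ 0] by auto
    then show ?thesis using XP unfolding End_def vP
      unfolding Perf_def full_subcategory_def derived_category_def 
      by (auto simp: le_Suc_eq)
  qed
  have coh: "dg_coherent Y f {0, 1} \<longleftrightarrow>
      (\<forall>k. \<forall>x\<in>carrier (term_at C k). diff C k (f {0, 1} k x) = f {0, 1} (k - 1) (diff C k x))"
    if Y: "Y = (\<lambda>i\<in>{..1}. C)" and f: "\<forall>k. linear_map CC (term_at C k) (term_at C k) (f {0,1} k)"
    for Y f
  proof -
    have mm: "Min {0, 1::nat} = 0" "Max {0, 1::nat} = 1" by simp_all
    have eq: "diff C k (f {0,1} k x) \<ominus>\<^bsub>term_at C (k - 1)\<^esub>
           (1 \<odot>\<^bsub>term_at C (k - 1)\<^esub> f {0,1} (k - 1) (diff C k x)) = \<zero>\<^bsub>term_at C (k - 1)\<^esub>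
        \<longleftrightarrow> diff C k (f {0, 1} k x) = f {0, 1} (k - 1) (diff C k x)"
      if x: "x \<in> carrier (term_at C k)" for k x
    proof -
      interpret d: linear_map CC "term_at C k" "term_at C (k - 1)" "diff C k"
        using X' unfolding chain_complex_def by blast
      have W: "module CC (term_at C (k - 1))"
        using X' unfolding chain_complex_def linear_map_def vectorspace_def by blast
      interpret f0: linear_map CC "term_at C k" "term_at C k" "f {0,1} k" using f by blast
      interpret f1: linear_map CC "term_at C (k-1)" "term_at C (k-1)" "f {0,1} (k-1)" using f by blast
      have a: "diff C k (f {0,1} k x) \<in> carrier (term_at C (k - 1))"
        "f {0, 1} (k - 1) (diff C k x) \<in> carrier (term_at C (k - 1))"
        using x d.f_hom f0.f_hom f1.f_hom unfolding module_hom_def by auto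
      have ag: "abelian_group (term_at C (k - 1))" by (rule module.axioms(2)[OF W])
      have G: "u \<ominus>\<^bsub>term_at C (k - 1)\<^esub> v = \<zero>\<^bsub>term_at C (k - 1)\<^esub> \<longleftrightarrow> u = v"
        if "u \<in> carrier (term_at C (k - 1))" "v \<in> carrier (term_at C (k - 1))" for u v
        using that abelian_group.minus_equality[OF ag, of u "a_inv (term_at C (k - 1)) v"]
        by (auto simp: a_minus_def abelian_group.r_neg[OF ag]
            abelian_group.minus_minus[OF ag]
            abelian_group.a_inv_closed[OF ag])
      show ?thesis using module.smult_one[OF W a(2)] G[OF a] by simp
    qed
    have fs: "finsum (term_at C j) g {} = \<zero>\<^bsub>term_at C j\<^esub>" for j and g :: "nat \<Rightarrow> 'v"
      using X'(1) unfolding chain_complex_def linear_map_def vectorspace_def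
      by (intro abelian_monoid.finsum_empty abelian_group.axioms(1) module.axioms(2)) blast
    show ?thesis unfolding dg_coherent_def Let_def mm Y
      by (simp add: fdeg_def fs eq[symmetric] del: One_nat_def cong: ball_cong)
  qed
  show ?thesis
  proof
    assume "T \<in> End Perf X"
    then have T: "T \<in> dg_simplices 1" 
        "vertex derived_category 0 T = X" "vertex derived_category 1 T = X" using E by auto
    obtain Y f where Yf: "T = (Y, f)" by (cases T)
    have Y0: "Y 0 = C" "Y 1 = C" using T(2,3)[unfolded Yf vx, THEN arg_cong, of complex_of] by (simp_all add: C_def)
    have Y: "Y = (\<lambda>i\<in>{..1}. C)"
      using T(1) Y0 unfolding Yf dg_simplices_def 
      by (auto simp: PiE_def extensional_def fun_eq_iff le_Suc_eq)
    have ff: "f \<in> (\<Pi>\<^sub>E I\<in>{{0,1}}. Hom_deg (Y (Min I)) (Y (Max I)) (fdeg I))" "dg_coherent Y f {0,1}"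
      using T(1) unfolding Yf dg_simplices_def nerve_index_1 by auto
    have hd: "f {0,1} \<in> Hom_deg C C 0" using ff(1) unfolding PiE_iff by (auto simp: Y fdeg_def)
    have f: "f = (\<lambda>I\<in>{{0,1}}. f {0,1})" using ff(1) by (auto simp: PiE_def extensional_def fun_eq_iff)
    have "?R (f {0,1})"
      using Yf Y f hd ff(2) coh[OF Y] by (auto simp: Hom_deg_def)
    then show "\<exists>\<phi>. ?R \<phi>" by blast
  next
    assume "\<exists>\<phi>. ?R \<phi>"
    then obtain \<phi> where R: "?R \<phi>" by blast
    have "T \<in> dg_simplices 1"
      using R X'(1) coh[OF refl, of "\<lambda>I\<in>{{0,1}}. \<phi>"]
      by (auto simp: dg_simplices_def nerve_index_1 Hom_deg_def fdeg_def PiE_iff simp del: One_nat_def)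
    moreover have "vertex derived_category 0 T = X" "vertex derived_category 1 T = X"
      using R X'(2) by (auto simp: vx)
    ultimately show "T \<in> End Perf X" using E by blast
  qed
qed


end

theory Submission
  imports Defs
begin

text \<open>
  A single polynomial \<open>p\<close> satisfies \<open>p(H\<^sub>i(T)) = f(H\<^sub>i(T))\<close> for all \<open>i\<close> at once, and then the chain map
  \<open>p(T)\<close> is the required endomorphism.  Boundedness of the complex and finite-dimensionality of its
  homology yield one polynomial \<open>m \<noteq> 0\<close> annihilating every \<open>H\<^sub>i(T)\<close>.  The coefficients of the remainders
  of \<open>z\<^sup>k\<close> modulo (a multiple of) \<open>m\<close> grow at most geometrically in \<open>k\<close>, whereas the Taylor coefficients
  of \<open>f\<close> decay faster than every geometric sequence; hence the partial sums of \<open>f\<close>, reduced modulo \<open>m\<close>,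
  converge coefficientwise to a polynomial \<open>p\<close>, and coefficientwise convergence in bounded degree
  implies convergence in operator norm.
\<close>

section \<open>Polynomials in an endomorphism\<close>

text \<open>Horner's scheme for \<open>p(A) v\<close>: folding over the coefficients gives a
  recursion along \<open>pCons\<close>, on which the inductions below run.\<close>

definition poly_act :: "(complex, 'w) module \<Rightarrow> ('w \<Rightarrow> 'w) \<Rightarrow> complex poly \<Rightarrow> 'w \<Rightarrow> 'w" where
  "poly_act V A p = fold_coeffs (\<lambda>a h v. a \<odot>\<^bsub>V\<^esub> v \<oplus>\<^bsub>V\<^esub> A (h v)) p (\<lambda>_. \<zero>\<^bsub>V\<^esub>)"

lemma poly_act_0 [simp]: "poly_act V A 0 v = \<zero>\<^bsub>V\<^esub>"
  by (simp add: poly_act_def)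

text \<open>Evaluation uses only the operations of \<open>V\<close>, so on a space of cycles it
  agrees with evaluation on the ambient term of the complex.\<close>

lemma poly_act_carrier_update [simp]: "poly_act (V\<lparr>carrier := Z\<rparr>) A p = poly_act V A p"
  by (simp add: poly_act_def)

locale vs_endomorphism = vectorspace CC V for V :: "(complex, 'w) module" +
  fixes A :: "'w \<Rightarrow> 'w"
  assumes linear: "linear_map CC V V A"
begin

lemma endo_closed [simp, intro]: "v \<in> carrier V \<Longrightarrow> A v \<in> carrier V"
  using linear by (auto simp: linear_map_def mod_hom_def mod_hom_axioms_def module_hom_def)

lemma endo_add [simp]:
  "v \<in> carrier V \<Longrightarrow> w \<in> carrier V \<Longrightarrow> A (v \<oplus>\<^bsub>V\<^esub> w) = A v \<oplus>\<^bsub>V\<^esub> A w"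
  using linear by (auto simp: linear_map_def mod_hom_def mod_hom_axioms_def module_hom_def)

lemma endo_smult [simp]: "v \<in> carrier V \<Longrightarrow> A (c \<odot>\<^bsub>V\<^esub> v) = c \<odot>\<^bsub>V\<^esub> A v"
  using linear by (auto simp: linear_map_def mod_hom_def mod_hom_axioms_def module_hom_def)

lemma zero_smult [simp]: "v \<in> carrier V \<Longrightarrow> 0 \<odot>\<^bsub>V\<^esub> v = \<zero>\<^bsub>V\<^esub>"
  using lmult_0[of v] by simp

lemma endo_zero [simp]: "A \<zero>\<^bsub>V\<^esub> = \<zero>\<^bsub>V\<^esub>"
  using endo_smult[of "\<zero>\<^bsub>V\<^esub>" 0] lmult_0[of "\<zero>\<^bsub>V\<^esub>"] lmult_0[of "A \<zero>\<^bsub>V\<^esub>"] by auto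

lemma smult_closed' [simp, intro]: "v \<in> carrier V \<Longrightarrow> c \<odot>\<^bsub>V\<^esub> v \<in> carrier V"
  using smult_closed[of c v] by simp

lemma funpow_closed [simp, intro]: "v \<in> carrier V \<Longrightarrow> (A ^^ k) v \<in> carrier V"
  by (induction k) auto

text \<open>For \<open>a = 0\<close> and \<open>p = 0\<close> the fold sees the zero polynomial, and
  the recursion still holds because \<open>A\<close> fixes zero.\<close>

lemma poly_act_pCons [simp]:
  "v \<in> carrier V \<Longrightarrow> poly_act V A (pCons a p) v = a \<odot>\<^bsub>V\<^esub> v \<oplus>\<^bsub>V\<^esub> A (poly_act V A p v)"
  using lmult_0[of v]
  by (cases "a = 0 \<and> p = 0") (auto simp: poly_act_def)

lemma poly_act_closed [simp, intro]: "v \<in> carrier V \<Longrightarrow> poly_act V A p v \<in> carrier V"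
  by (induction p) auto

lemma poly_act_vadd:
  "v \<in> carrier V \<Longrightarrow> w \<in> carrier V \<Longrightarrow>
    poly_act V A p (v \<oplus>\<^bsub>V\<^esub> w) = poly_act V A p v \<oplus>\<^bsub>V\<^esub> poly_act V A p w"
  using smult_r_distr by (induction p) (auto simp: a_ac)

lemma poly_act_vsmult:
  "v \<in> carrier V \<Longrightarrow> poly_act V A p (c \<odot>\<^bsub>V\<^esub> v) = c \<odot>\<^bsub>V\<^esub> poly_act V A p v"
proof (induction p)
  case (pCons a p)
  then show ?case
    using smult_r_distr[of c "a \<odot>\<^bsub>V\<^esub> v" "A (poly_act V A p v)"]
      smult_assoc1[of a c v] smult_assoc1[of c a v] by (simp add: mult.commute)
qed auto

lemma linear_map_poly_act: "linear_map CC V V (poly_act V A p)"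
  using vectorspace_axioms
  by (auto simp: linear_map_def mod_hom_def mod_hom_axioms_def module_hom_def vectorspace_def
      poly_act_vadd poly_act_vsmult)

lemma poly_act_add:
  assumes "v \<in> carrier V"
  shows "poly_act V A (p + q) v = poly_act V A p v \<oplus>\<^bsub>V\<^esub> poly_act V A q v"
proof (induction p q rule: poly_induct2)
  case (pCons a p b q)
  then show ?case using assms smult_l_distr[of a b v] by (auto simp: a_ac)
qed (use assms in auto)

lemma poly_act_smult:
  assumes "v \<in> carrier V"
  shows "poly_act V A (Polynomial.smult c p) v = c \<odot>\<^bsub>V\<^esub> poly_act V A p v"
proof (induction p)
  case (pCons a p)
  then show ?case
    using assms smult_r_distr[of c "a \<odot>\<^bsub>V\<^esub> v" "A (poly_act V A p v)"]
      smult_assoc1[of c a v] by simp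
qed auto

lemma poly_act_diff:
  assumes "v \<in> carrier V"
  shows "poly_act V A (p - q) v = poly_act V A p v \<ominus>\<^bsub>V\<^esub> poly_act V A q v"
proof -
  have "poly_act V A (p - q) v \<oplus>\<^bsub>V\<^esub> poly_act V A q v = poly_act V A p v"
    using poly_act_add[OF assms, of "p - q" q] by simp
  then show ?thesis using assms
    by (metis a_assoc a_minus_def poly_act_closed r_neg r_zero a_inv_closed)
qed

text \<open>With \<open>poly_act_add\<close> and \<open>poly_act_smult\<close> this makes
  \<open>p \<mapsto> p(A)\<close> an algebra homomorphism, so divisibility of polynomials transfers
  to annihilation.\<close>

lemma poly_act_mult:
  assumes "v \<in> carrier V"
  shows "poly_act V A (p * q) v = poly_act V A p (poly_act V A q v)"
  using assms by (induction p) (simp_all add: poly_act_add poly_act_smult)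

text \<open>If \<open>q = r * p\<close>, then \<open>q(A) v = r(A) (p(A) v)\<close>, and
  \<open>r(A)\<close> fixes zero by homogeneity. The form for a single vector allows annihilators of
  different basis vectors to be multiplied together.\<close>

lemma poly_act_dvd:
  assumes "v \<in> carrier V" "p dvd q" "poly_act V A p v = \<zero>\<^bsub>V\<^esub>"
  shows "poly_act V A q v = \<zero>\<^bsub>V\<^esub>"
proof -
  obtain r where "q = r * p" using assms(2) by (metis dvd_def mult.commute)
  moreover have "poly_act V A r \<zero>\<^bsub>V\<^esub> = \<zero>\<^bsub>V\<^esub>"
    using lmult_0[of "\<zero>\<^bsub>V\<^esub>"] poly_act_vsmult[of "\<zero>\<^bsub>V\<^esub>" r 0]
      lmult_0[of "poly_act V A r \<zero>\<^bsub>V\<^esub>"] by auto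
  ultimately show ?thesis using assms by (simp add: poly_act_mult)
qed

lemma poly_act_monom:
  "v \<in> carrier V \<Longrightarrow> poly_act V A (monom c k) v = c \<odot>\<^bsub>V\<^esub> (A ^^ k) v"
  by (induction k) (auto simp: monom_0 monom_Suc)

lemma poly_act_sum:
  assumes "v \<in> carrier V" "finite I"
  shows "poly_act V A (\<Sum>i\<in>I. p i) v = (\<Oplus>\<^bsub>V\<^esub>i\<in>I. poly_act V A (p i) v)"
  using assms(2)
proof (induction I rule: finite_induct)
  case (insert i I)
  have "(\<lambda>j. poly_act V A (p j) v) \<in> I \<rightarrow> carrier V" using assms by auto
  then show ?case using insert assms by (simp add: poly_act_add)
qed simp

end

text \<open>Intertwining passes through each Horner step. With \<open>g\<close> the differential
  this makes \<open>p(T)\<close> a chain map; with \<open>g\<close> the passage from cycles to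
  homology classes it gives \<open>H_i(p(T)) = p(H_i(T))\<close>.\<close>

lemma poly_act_commute:
  assumes A: "vs_endomorphism V A" and B: "vs_endomorphism W B" and g: "linear_map CC V W g"
    and c: "\<And>v. v \<in> carrier V \<Longrightarrow> g (A v) = B (g v)" and v: "v \<in> carrier V"
  shows "g (poly_act V A p v) = poly_act W B p (g v)"
proof -
  interpret A: vs_endomorphism V A by (rule A)
  interpret B: vs_endomorphism W B by (rule B)
  interpret g: linear_map CC V W g by (rule g)
  show ?thesis by (induction p) (use c v g.f_smult in \<open>auto\<close>)
qed


section \<open>Annihilating polynomials in finite dimension\<close>

context vs_endomorphism
begin

text \<open>Linear dependence concerns sets of vectors, so repetitions in the orbit of
  \<open>v\<close> are treated apart: distinct iterates form an infinite, hence dependent, set,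
  while a coincidence of two iterates is itself a polynomial relation.\<close>

lemma ex_annihilating_poly_vector:
  assumes fd: "fin_dim" and v: "v \<in> carrier V"
  shows "\<exists>q. q \<noteq> 0 \<and> poly_act V A q v = \<zero>\<^bsub>V\<^esub>"
proof (cases "inj (\<lambda>k. (A ^^ k) v)")
  case True
  let ?S = "range (\<lambda>k. (A ^^ k) v)"
  have "infinite ?S" using True by (simp add: finite_image_iff)
  then have "lin_dep ?S" using fin_dim_li_fin[OF fd, of ?S] v by blast
  then obtain B a w where B: "finite B" "B \<subseteq> ?S" "lincomb a B = \<zero>\<^bsub>V\<^esub>" "w \<in> B" "a w \<noteq> 0"
    unfolding lin_dep_def by auto
  \<comment> \<open>\<open>ix\<close> recovers the exponent of an iterate, turning a relation
    between vectors into a polynomial. Distinct vectors of \<open>B\<close> have distinct exponents,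
    so no two terms of \<open>q\<close> collide and \<open>q\<close> keeps the coefficient
    \<open>a w\<close>.\<close>
  define ix where "ix = inv_into UNIV (\<lambda>k. (A ^^ k) v)"
  have ix: "(A ^^ ix b) v = b" if "b \<in> B" for b
    using f_inv_into_f[of b "\<lambda>k. (A ^^ k) v" UNIV] that B(2) unfolding ix_def by auto
  have inj: "ix b = ix w \<longleftrightarrow> b = w" if "b \<in> B" for b
    using ix that B(4) by metis
  define q where "q = (\<Sum>b\<in>B. monom (a b) (ix b))"
  have "coeff q (ix w) = (\<Sum>b\<in>B. if b = w then a b else 0)"
    unfolding q_def coeff_sum by (intro sum.cong) (auto simp: inj)
  then have "coeff q (ix w) = a w" using B by simp
  then have "q \<noteq> 0" using B(5) by auto
  moreover have "poly_act V A q v = (\<Oplus>\<^bsub>V\<^esub>b\<in>B. a b \<odot>\<^bsub>V\<^esub> (A ^^ ix b) v)"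
    unfolding q_def using v B(1) by (simp add: poly_act_sum poly_act_monom)
  moreover have "\<dots> = lincomb a B"
    unfolding lincomb_def using ix B(2) v by (intro finsum_cong') auto
  ultimately show ?thesis using B(3) by auto
next
  case False
  then obtain i j where ij: "i \<noteq> j" "(A ^^ i) v = (A ^^ j) v" by (auto simp: inj_def)
  define q :: "complex poly" where "q = monom 1 i - monom 1 j"
  have "coeff q i = 1" using ij by (simp add: q_def)
  then have "q \<noteq> 0" by auto
  moreover have "poly_act V A q v = \<zero>\<^bsub>V\<^esub>"
    using v ij by (simp add: q_def poly_act_diff poly_act_monom a_minus_def r_neg)
  ultimately show ?thesis by blast
qed

text \<open>The product of annihilators of the basis vectors works: its kernel is a submodule
  containing a basis.\<close>

lemma ex_annihilating_poly:
  assumes fd: "fin_dim"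
  shows "\<exists>q. q \<noteq> 0 \<and> (\<forall>v\<in>carrier V. poly_act V A q v = \<zero>\<^bsub>V\<^esub>)"
proof -
  obtain S where S: "finite S" "basis S" using finite_basis_exists[OF fd] by blast
  then have Sc: "S \<subseteq> carrier V" and Sg: "span S = carrier V" by (auto simp: basis_def)
  obtain Q where Q: "\<And>b. b \<in> S \<Longrightarrow> Q b \<noteq> 0 \<and> poly_act V A (Q b) b = \<zero>\<^bsub>V\<^esub>"
    using ex_annihilating_poly_vector[OF fd] Sc by (metis subsetD)
  define q where "q = (\<Prod>b\<in>S. Q b)"
  interpret q: linear_map CC V V "poly_act V A q" by (rule linear_map_poly_act)
  have "S \<subseteq> q.ker"
  proof
    fix b assume b: "b \<in> S"
    have "poly_act V A q b = \<zero>\<^bsub>V\<^esub>"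
      by (rule poly_act_dvd[where p = "Q b"]) (use b Sc Q S in \<open>auto simp: q_def\<close>)
    then show "b \<in> q.ker" using b Sc by (auto simp: q.ker_def)
  qed
  then have "span S \<subseteq> q.ker"
    using q.ker_is_submodule by (rule span_is_subset)
  moreover have "q \<noteq> 0" using Q S by (auto simp: q_def)
  ultimately show ?thesis using Sg by (auto simp: q.ker_def)
qed

end

section \<open>Norms on finite-dimensional spaces\<close>

lemma vs_norm_finsum_le:
  assumes V: "vectorspace CC V" and N: "vs_norm V N" and "finite I" "g \<in> I \<rightarrow> carrier V"
  shows "N (\<Oplus>\<^bsub>V\<^esub>i\<in>I. g i) \<le> (\<Sum>i\<in>I. N (g i))"
proof -
  interpret vectorspace CC V by (rule V)
  show ?thesis using assms(3,4)
  proof (induction I rule: finite_induct)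
    case empty
    have "N \<zero>\<^bsub>V\<^esub> = 0" using N zero_closed unfolding vs_norm_def by blast
    then show ?case by simp
  next
    case (insert i I)
    have "N (g i \<oplus>\<^bsub>V\<^esub> (\<Oplus>\<^bsub>V\<^esub>i\<in>I. g i)) \<le> N (g i) + N (\<Oplus>\<^bsub>V\<^esub>i\<in>I. g i)"
      using N insert by (auto simp: vs_norm_def)
    then show ?case using insert by (simp add: Pi_def)
  qed
qed

text \<open>The unit sphere of the coordinate norm is compact, so the continuous function
  \<open>a \<mapsto> N (lincomb a S)\<close> attains a minimum on it, which is positive by linear independence.\<close>

lemma vs_norm_lincomb_ge:
  fixes V :: "(complex, 'w) module"
  assumes V: "vectorspace CC V" and N: "vs_norm V N"
    and S: "finite S" "S \<subseteq> carrier V" "\<not> module.lin_dep CC V S"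
  shows "\<exists>c>0. \<forall>a. c * (\<Sum>b\<in>S. cmod (a b)) \<le> N (module.lincomb V a S)"
proof -
  interpret vectorspace CC V by (rule V)
  have Nn: "0 \<le> N v" "N v = 0 \<longleftrightarrow> v = \<zero>\<^bsub>V\<^esub>" "N (c \<odot>\<^bsub>V\<^esub> v) = cmod c * N v"
    if "v \<in> carrier V" for v c
    using that N by (auto simp: vs_norm_def)
  have lc: "lincomb a S \<in> carrier V" for a using S(2) by (intro lincomb_closed) auto
  define g where "g a = N (lincomb a S)" for a :: "'w \<Rightarrow> complex"
  have up: "g a \<le> (\<Sum>b\<in>S. cmod (a b) * N b)" for a
  proof -
    have cl: "(\<lambda>b. a b \<odot>\<^bsub>V\<^esub> b) \<in> S \<rightarrow> carrier V" using S(2) by (auto intro!: smult_closed)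
    have "g a \<le> (\<Sum>b\<in>S. N (a b \<odot>\<^bsub>V\<^esub> b))"
      unfolding g_def lincomb_def by (rule vs_norm_finsum_le[OF V N S(1) cl])
    also have "\<dots> = (\<Sum>b\<in>S. cmod (a b) * N b)"
      using S(2) by (intro sum.cong) (auto simp: Nn)
    finally show ?thesis .
  qed
  \<comment> \<open>Subadditivity gives a Lipschitz estimate for \<open>g\<close> in the
    coordinates; exchanging \<open>a\<close> and \<open>a'\<close> makes it two-sided.\<close>
  have tri: "g a \<le> g a' + (\<Sum>b\<in>S. cmod (a b - a' b) * N b)" for a a'
  proof -
    have "lincomb a S = lincomb a' S \<oplus>\<^bsub>V\<^esub> lincomb (\<lambda>b. a b - a' b) S"
      using lincomb_sum[OF S(1,2), of a' "\<lambda>b. a b - a' b"] by simp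
    then have "g a \<le> g a' + g (\<lambda>b. a b - a' b)" using N lc by (simp add: g_def vs_norm_def)
    then show ?thesis using up[of "\<lambda>b. a b - a' b"] by linarith
  qed
  have dif: "\<bar>g a - g a'\<bar> \<le> (\<Sum>b\<in>S. cmod (a b - a' b) * N b)" for a a'
  proof -
    have "(\<Sum>b\<in>S. cmod (a' b - a b) * N b) = (\<Sum>b\<in>S. cmod (a b - a' b) * N b)"
      by (intro sum.cong refl arg_cong2[where f = times] norm_minus_commute)
    then show ?thesis using tri[of a a'] tri[of a' a] by linarith
  qed
  \<comment> \<open>Functions carry the product topology, so coordinates are continuous; the
    variation of \<open>g\<close> is controlled by the finitely many coordinates in
    \<open>S\<close>.\<close>
  have coord: "continuous_on UNIV (\<lambda>a :: 'w \<Rightarrow> complex. a b)" for b by simp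
  have cont: "continuous_on UNIV g"
    unfolding continuous_on_def
  proof
    fix a :: "'w \<Rightarrow> complex"
    have t: "((\<lambda>a'. a' b) \<longlongrightarrow> a b) (at a)" for b
      using coord[of b] unfolding continuous_on_def by blast
    have "((\<lambda>a'. \<Sum>b\<in>S. cmod (a' b - a b) * N b) \<longlongrightarrow> (\<Sum>b\<in>S. cmod (a b - a b) * N b)) (at a)"
      by (intro tendsto_sum tendsto_mult tendsto_norm tendsto_diff t tendsto_const)
    then have z: "((\<lambda>a'. \<Sum>b\<in>S. cmod (a' b - a b) * N b) \<longlongrightarrow> 0) (at a)" by simp
    have "((\<lambda>a'. g a' - g a) \<longlongrightarrow> 0) (at a)"
      by (rule Lim_null_comparison[OF _ z]) (simp add: dif)
    then show "(g \<longlongrightarrow> g a) (at a within UNIV)" by (rule Lim_null[THEN iffD2])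
  qed
  \<comment> \<open>Coordinates outside \<open>S\<close> are pinned to 0, which makes
    \<open>P\<close> compact by Tychonoff on the full function type. \<open>K\<close> is the unit
    sphere inside \<open>P\<close>.\<close>
  define P where "P = (\<Pi>\<^sub>E b\<in>UNIV. if b \<in> S then cball (0::complex) 1 else {0})"
  define K where "K = {a \<in> P. (\<Sum>b\<in>S. cmod (a b)) = 1}"
  have "compactin (product_topology (\<lambda>_. euclidean) UNIV) P"
    unfolding P_def compactin_PiE by auto
  then have "compact P" by (simp add: euclidean_product_topology)
  moreover have "closed ((\<lambda>a. \<Sum>b\<in>S. cmod (a b)) -` {1})"
    by (rule closed_vimage)
      (auto intro!: continuous_on_sum continuous_on_norm continuous_on_product_coordinates)
  ultimately have "compact (P \<inter> (\<lambda>a. \<Sum>b\<in>S. cmod (a b)) -` {1})"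
    by (rule compact_Int_closed)
  also have "P \<inter> (\<lambda>a. \<Sum>b\<in>S. cmod (a b)) -` {1} = K" by (auto simp: K_def)
  finally have cK: "compact K" .
  \<comment> \<open>By homogeneity, a bound on the sphere \<open>K\<close> extends to all
    coefficient families with nonzero coordinate sum.\<close>
  have scale: "\<exists>e\<in>K. g a = (\<Sum>b\<in>S. cmod (a b)) * g e" if pos: "(\<Sum>b\<in>S. cmod (a b)) > 0" for a
  proof -
    define s where "s = (\<Sum>b\<in>S. cmod (a b))"
    define e where "e = (\<lambda>b. if b \<in> S then a b / s else 0)"
    have s0: "s > 0" using pos by (simp add: s_def)
    have "lincomb a S = lincomb (\<lambda>b. s * e b) S"
      using S(2) s0 by (intro lincomb_cong) (auto simp: e_def)
    also have "\<dots> = s \<odot>\<^bsub>V\<^esub> lincomb e S" using lincomb_smult[OF S(2), of e s] by simp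
    finally have "g a = s * g e" using s0 lc by (simp add: g_def Nn)
    moreover have "e \<in> K"
    proof -
      have "(\<Sum>b\<in>S. cmod (e b)) = (\<Sum>b\<in>S. cmod (a b) / s)"
        by (intro sum.cong) (use s0 in \<open>auto simp: e_def norm_divide\<close>)
      then have 1: "(\<Sum>b\<in>S. cmod (e b)) = 1"
        using s0 by (simp add: sum_divide_distrib[symmetric] s_def[symmetric])
      then have "cmod (e b) \<le> 1" if "b \<in> S" for b
        using member_le_sum[of b S "\<lambda>b. cmod (e b)"] that S(1) by simp
      then show ?thesis using 1 by (auto simp: K_def P_def e_def)
    qed
    ultimately show ?thesis unfolding s_def by blast
  qed
  have ex: "\<exists>c>0. \<forall>a\<in>K. c \<le> g a"
  \<comment> \<open>\<open>K\<close> is empty when \<open>S\<close> is; then any positive constant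
    serves, here 1.\<close>
  proof (cases "K = {}")
    case False
    obtain k where k: "k \<in> K" "\<And>a. a \<in> K \<Longrightarrow> g k \<le> g a"
      using continuous_attains_inf[OF cK False continuous_on_subset[OF cont]] by blast
    \<comment> \<open>A zero of \<open>g\<close> on \<open>K\<close> would be a linear relation on
      \<open>S\<close>, forcing all coordinates to vanish although they have absolute sum 1.\<close>
    have "g k \<noteq> 0"
    proof
      assume "g k = 0"
      then have "lincomb k S = \<zero>\<^bsub>V\<^esub>" using lc by (simp add: g_def Nn)
      then have "k b = 0" if "b \<in> S" for b
        using lin_dep_crit[OF S(1) order.refl, of k b] S(3) that by auto
      then show False using k(1) by (simp add: K_def)
    qed
    moreover have "g k \<ge> 0" using lc by (simp add: g_def Nn)
    ultimately show ?thesis using k(2) by (intro exI[of _ "g k"]) auto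
  qed (auto intro: exI[of _ 1])
  then obtain c where c: "c > 0" "\<And>a. a \<in> K \<Longrightarrow> c \<le> g a" by blast
  have "c * (\<Sum>b\<in>S. cmod (a b)) \<le> g a" for a
  proof (cases "(\<Sum>b\<in>S. cmod (a b)) > 0")
    case True
    then obtain e where e: "e \<in> K" "g a = (\<Sum>b\<in>S. cmod (a b)) * g e" using scale by blast
    then show ?thesis using mult_right_mono[OF c(2)[OF e(1)], of "\<Sum>b\<in>S. cmod (a b)"] True
      by (simp add: mult.commute)
  next
    case False
    then have "(\<Sum>b\<in>S. cmod (a b)) = 0" by (meson not_less antisym sum_nonneg norm_ge_zero)
    then show ?thesis using lc by (simp add: g_def Nn)
  qed
  then show ?thesis using c(1) by (auto simp: g_def)
qed

section \<open>Operator bounds and convergence of the functional calculus\<close>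

context vs_endomorphism
begin

text \<open>Expanding \<open>v\<close> in a basis bounds \<open>N (A v)\<close> by a multiple of the
  coordinate sum, which \<open>vs_norm_lincomb_ge\<close> bounds by a multiple of
  \<open>N v\<close>.\<close>

lemma endo_bounded:
  assumes fd: "fin_dim" and N: "vs_norm V N"
  shows "\<exists>K\<ge>0. \<forall>v\<in>carrier V. N (A v) \<le> K * N v"
proof -
  have Nn: "0 \<le> N v" "N (c \<odot>\<^bsub>V\<^esub> v) = cmod c * N v" if "v \<in> carrier V" for v c
    using that N by (auto simp: vs_norm_def)
  obtain S where S: "finite S" "basis S" using finite_basis_exists[OF fd] by blast
  then have Sc: "S \<subseteq> carrier V" and Sg: "span S = carrier V" and Si: "\<not> lin_dep S"
    by (auto simp: basis_def)
  obtain c where c: "c > 0" "\<And>a. c * (\<Sum>b\<in>S. cmod (a b)) \<le> N (lincomb a S)"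
    using vs_norm_lincomb_ge[OF vectorspace_axioms N S(1) Sc Si] by blast
  \<comment> \<open>The sum dominates each \<open>N (A b)\<close> and, unlike a maximum, is also
    defined for an empty basis.\<close>
  define M where "M = (\<Sum>b\<in>S. N (A b))"
  have M0: "M \<ge> 0" unfolding M_def using Sc by (intro sum_nonneg) (auto intro!: Nn)
  interpret A: linear_map CC V V A by (rule linear)
  have "N (A v) \<le> M / c * N v" if v: "v \<in> carrier V" for v
  proof -
    obtain a where a: "lincomb a S = v"
      using finite_in_span[OF S(1) Sc, of v] v Sg by auto
    have cl: "(\<lambda>b. a b \<odot>\<^bsub>V\<^esub> b) \<in> S \<rightarrow> carrier V" using Sc by auto
    have "A v = (\<Oplus>\<^bsub>V\<^esub>b\<in>S. A (a b \<odot>\<^bsub>V\<^esub> b))"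
      unfolding a[symmetric] lincomb_def by (rule A.hom_sum[OF Sc cl])
    then have "N (A v) \<le> (\<Sum>b\<in>S. N (A (a b \<odot>\<^bsub>V\<^esub> b)))"
      using Sc by (auto intro!: vs_norm_finsum_le[OF vectorspace_axioms N S(1)])
    also have "\<dots> = (\<Sum>b\<in>S. cmod (a b) * N (A b))"
      using Sc by (intro sum.cong) (auto simp: Nn)
    also have "\<dots> \<le> (\<Sum>b\<in>S. cmod (a b) * M)"
      unfolding M_def using Sc S(1)
      by (intro sum_mono mult_left_mono member_le_sum) (auto intro!: Nn)
    also have "\<dots> = M * (\<Sum>b\<in>S. cmod (a b))" by (simp add: sum_distrib_left mult.commute)
    also have "\<dots> \<le> M * (N v / c)"
      using c(2)[of a] c(1) M0 a by (intro mult_left_mono) (auto simp: field_simps)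
    finally show ?thesis by simp
  qed
  moreover have "M / c \<ge> 0" using M0 c by simp
  ultimately show ?thesis by blast
qed

text \<open>Summing up to a fixed \<open>d\<close> instead of \<open>degree p\<close> gives one
  bound for a whole family of polynomials, tending to 0 when all coefficients do.\<close>

lemma poly_act_norm_le:
  assumes N: "vs_norm V N" and K: "K \<ge> 0" "\<And>v. v \<in> carrier V \<Longrightarrow> N (A v) \<le> K * N v"
    and d: "degree p \<le> d" and v: "v \<in> carrier V"
  shows "N (poly_act V A p v) \<le> (\<Sum>j\<le>d. cmod (coeff p j) * K ^ j) * N v"
proof -
  have pw: "N ((A ^^ j) v) \<le> K ^ j * N v" for j
  proof (induction j)
    case (Suc j)
    have "N ((A ^^ Suc j) v) \<le> K * N ((A ^^ j) v)" using K(2) v by simp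
    also have "\<dots> \<le> K * (K ^ j * N v)" using Suc K(1) by (rule mult_left_mono)
    finally show ?case by (simp add: mult.assoc)
  qed simp
  have "poly_act V A p v = poly_act V A (\<Sum>j\<le>d. monom (coeff p j) j) v"
    using poly_as_sum_of_monoms'[OF d] by simp
  also have "\<dots> = (\<Oplus>\<^bsub>V\<^esub>j\<in>{..d}. coeff p j \<odot>\<^bsub>V\<^esub> (A ^^ j) v)"
    using v by (simp add: poly_act_sum poly_act_monom)
  finally have "N (poly_act V A p v) \<le> (\<Sum>j\<le>d. N (coeff p j \<odot>\<^bsub>V\<^esub> (A ^^ j) v))"
    using v by (auto intro!: vs_norm_finsum_le[OF vectorspace_axioms N])
  also have "\<dots> = (\<Sum>j\<le>d. cmod (coeff p j) * N ((A ^^ j) v))"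
    using v N by (intro sum.cong) (auto simp: vs_norm_def)
  also have "\<dots> \<le> (\<Sum>j\<le>d. cmod (coeff p j) * (K ^ j * N v))"
    using pw by (intro sum_mono mult_left_mono) auto
  finally show ?thesis by (simp add: sum_distrib_right mult.assoc)
qed

text \<open>Since \<open>m(A) = 0\<close>, the error of the \<open>n\<close>-th partial sum is
  \<open>D n\<close> evaluated at \<open>A\<close>, and \<open>poly_act_norm_le\<close> makes it
  tend to 0 in operator norm. \<open>B\<close> is compared with \<open>p(A)\<close> on the carrier,
  which is where an induced map on homology is determined.\<close>

lemma functional_calculus_poly_act:
  assumes fd: "fin_dim"
    and m: "\<And>v. v \<in> carrier V \<Longrightarrow> poly_act V A m v = \<zero>\<^bsub>V\<^esub>"
    and D: "\<And>n. m dvd (\<Sum>k<n. monom (taylor_coeff f k) k) - p - D n"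
      "\<And>n. degree (D n) \<le> d" "\<And>j. (\<lambda>n. coeff (D n) j) \<longlonglongrightarrow> 0"
    and B: "linear_map CC V V B" "\<And>v. v \<in> carrier V \<Longrightarrow> B v = poly_act V A p v"
  shows "functional_calculus V f A B"
  unfolding functional_calculus_def
proof (intro conjI allI impI)
  show "linear_map CC V V B" by (rule B)
  fix N assume N: "vs_norm V N"
  obtain K where K: "K \<ge> 0" "\<And>v. v \<in> carrier V \<Longrightarrow> N (A v) \<le> K * N v"
    using endo_bounded[OF fd N] by blast
  define e where "e n = (\<Sum>j\<le>d. cmod (coeff (D n) j) * K ^ j)" for n
  have "e \<longlonglongrightarrow> (\<Sum>j\<le>d. cmod 0 * K ^ j)"
    unfolding e_def by (intro tendsto_intros D(3))
  then have e0: "e \<longlonglongrightarrow> 0" by simp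
  define E where "E n v = (\<Oplus>\<^bsub>V\<^esub>k\<in>{..<n}. taylor_coeff f k \<odot>\<^bsub>V\<^esub> (A ^^ k) v) \<ominus>\<^bsub>V\<^esub> B v" for n v
  have E: "E n v = poly_act V A (D n) v" if v: "v \<in> carrier V" for n v
  proof -
    let ?S = "\<Sum>k<n. monom (taylor_coeff f k) k"
    have "E n v = poly_act V A (?S - p) v"
      using v B(2) by (simp add: E_def poly_act_diff poly_act_sum poly_act_monom)
    \<comment> \<open>The bracketed part is a multiple of \<open>m\<close> and vanishes at
      \<open>A\<close>.\<close>
    also have "?S - p = (?S - p - D n) + D n" by simp
    also have "poly_act V A \<dots> v = poly_act V A (D n) v"
      using v poly_act_dvd[OF v D(1) m[OF v], of n] by (subst poly_act_add) auto
    finally show ?thesis .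
  qed
  have eb: "0 \<le> N (E n v) \<and> N (E n v) \<le> e n" if v: "v \<in> carrier V" "N v \<le> 1" for n v
  proof -
    have "N (E n v) \<le> e n * N v"
      unfolding E[OF v(1)] e_def by (rule poly_act_norm_le[OF N K D(2) v(1)])
    also have "\<dots> \<le> e n * 1"
      using v(2) K(1) by (intro mult_left_mono) (auto simp: e_def intro!: sum_nonneg)
    finally show ?thesis using N v(1) by (simp add: E vs_norm_def)
  qed
  \<comment> \<open>The zero vector makes the set under the supremum nonempty, and the nonnegative
    value there bounds the operator norm from below.\<close>
  have z: "\<zero>\<^bsub>V\<^esub> \<in> {v \<in> carrier V. N v \<le> 1}"
  proof -
    have "N \<zero>\<^bsub>V\<^esub> = 0" using N zero_closed unfolding vs_norm_def by blast
    then show ?thesis by simp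
  qed
  have ub: "operator_norm V N (E n) \<le> e n" for n
    unfolding operator_norm_def by (rule cSUP_least) (use z eb in auto)
  have lb: "0 \<le> operator_norm V N (E n)" for n
  proof -
    have "N (E n \<zero>\<^bsub>V\<^esub>) \<le> operator_norm V N (E n)"
      unfolding operator_norm_def
      by (rule cSUP_upper[OF z]) (use eb in \<open>auto intro!: bdd_aboveI2[where M = "e n"]\<close>)
    then show ?thesis using eb[of "\<zero>\<^bsub>V\<^esub>" n] z by auto
  qed
  have "(\<lambda>n. operator_norm V N (E n)) \<longlonglongrightarrow> 0"
    by (rule tendsto_sandwich[OF _ _ tendsto_const e0]) (auto simp: ub lb)
  then show "(\<lambda>n. operator_norm V N (\<lambda>v. (\<Oplus>\<^bsub>V\<^esub>k\<in>{..<n}. taylor_coeff f k \<odot>\<^bsub>V\<^esub> (A ^^ k) v) \<ominus>\<^bsub>V\<^esub> B v)) \<longlonglongrightarrow> 0"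
    by (simp add: E_def[abs_def])
qed

end

section \<open>Reducing an entire series modulo a polynomial\<close>

text \<open>Convergence at a point of larger modulus implies absolute convergence at
  \<open>R\<close>.\<close>

lemma entire_taylor_abs_summable:
  assumes "f holomorphic_on UNIV"
  shows "summable (\<lambda>k. cmod (taylor_coeff f k) * R ^ k)"
proof -
  \<comment> \<open>The added 1 makes the modulus strictly larger than
    \<open>\<bar>R\<bar>\<close>.\<close>
  define w :: complex where "w = of_real (\<bar>R\<bar> + 1)"
  have w: "cmod w = \<bar>R\<bar> + 1" unfolding w_def norm_of_real by simp
  have "f holomorphic_on ball 0 (cmod w + 1)"
    using assms holomorphic_on_subset by blast
  then have "(\<lambda>n. (deriv ^^ n) f 0 / fact n * (w - 0) ^ n) sums f w"
    by (rule holomorphic_power_series) simp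
  then have "summable (\<lambda>n. taylor_coeff f n * w ^ n)"
    by (auto simp: taylor_coeff_def sums_iff)
  then have "summable (\<lambda>n. cmod (taylor_coeff f n * of_real R ^ n))"
    by (rule powser_insidea) (simp add: w)
  then have "summable (\<lambda>n. cmod (taylor_coeff f n) * \<bar>R\<bar> ^ n)"
    by (simp add: norm_mult norm_power)
  \<comment> \<open>\<open>R\<close> may be negative, hence the comparison with
    \<open>\<bar>R\<bar> ^ k\<close>.\<close>
  then show ?thesis
    by (rule summable_comparison_test[rotated])
      (auto intro!: exI[of _ 0] simp: abs_mult power_abs)
qed

lemma power_series_mod_poly:
  fixes a :: "nat \<Rightarrow> complex" and m :: "complex poly"
  assumes a: "\<And>R. summable (\<lambda>k. cmod (a k) * R ^ k)" and m: "m \<noteq> 0"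
  obtains p D d where "\<And>n. m dvd (\<Sum>k<n. monom (a k) k) - p - D n"
    "\<And>n. degree (D n) \<le> d" "\<And>j. (\<lambda>n. coeff (D n) j) \<longlonglongrightarrow> 0"
proof -
  \<comment> \<open>The factor \<open>pCons 0\<close> makes the degree positive even if \<open>m\<close> is constant.\<close>
  define M where "M = pCons 0 (Polynomial.smult (inverse (lead_coeff m)) m)"
  \<comment> \<open>\<open>M\<close> is monic of degree \<open>Suc d\<close>, one more than
    \<open>m\<close>, so remainders modulo \<open>M\<close> have degree at most
    \<open>d\<close>.\<close>
  define d where "d = degree m"
  have M0: "degree M = Suc d" "coeff M (Suc d) = 1"
    using m by (auto simp: M_def d_def)
  have mM: "m dvd M"
    by (rule dvdI[of _ _ "[:0, inverse (lead_coeff m):]"]) (simp add: M_def)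
  \<comment> \<open>\<open>red k\<close> is the remainder of \<open>z^k\<close> modulo
    \<open>M\<close>: multiply the previous remainder by \<open>z\<close>, then cancel the
    coefficient at \<open>Suc d\<close> using that \<open>M\<close> is monic.\<close>
  define red :: "nat \<Rightarrow> complex poly" where
    "red = rec_nat 1 (\<lambda>_ r. pCons 0 r - Polynomial.smult (coeff r d) M)"
  have red: "red 0 = 1" "red (Suc k) = pCons 0 (red k) - Polynomial.smult (coeff (red k) d) M" for k
    by (simp_all add: red_def)
  have deg: "degree (red k) \<le> d" for k
  proof (induction k)
    case (Suc k)
    have "coeff (red (Suc k)) j = 0" if "d < j" for j
    proof (cases "j = Suc d")
      case True then show ?thesis by (simp add: red M0)
    next
      case False
      then have "coeff (red k) (j - 1) = 0" "coeff M j = 0"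
        using that Suc M0 by (auto intro!: coeff_eq_0)
      then show ?thesis using that by (cases j) (simp_all add: red)
    qed
    then show ?case by (intro degree_le) auto
  qed (simp add: red)
  have dvd: "M dvd monom 1 k - red k" for k
  proof (induction k)
    case (Suc k)
    have "monom 1 (Suc k) - red (Suc k)
        = [:0, 1:] * (monom 1 k - red k) + Polynomial.smult (coeff (red k) d) M"
      by (simp add: red monom_Suc)
    then show ?case using Suc by (metis dvd_add dvd_mult dvd_smult dvd_refl)
  qed (simp add: red)
  \<comment> \<open>Chosen so that one step of the recursion multiplies the coefficient bound by at
    most \<open>1 + (R - 1) = R\<close>.\<close>
  define R where "R = 1 + (\<Sum>j\<le>Suc d. cmod (coeff M j))"
  have R1: "cmod (coeff M j) \<le> R - 1" for j
  proof (cases "j \<le> Suc d")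
    case True
    then show ?thesis
      using member_le_sum[of j "{..Suc d}" "\<lambda>j. cmod (coeff M j)"]
      by (simp add: R_def del: sum.atMost_Suc)
  next
    case False then show ?thesis using M0 by (simp add: coeff_eq_0 R_def sum_nonneg)
  qed
  have R0: "R \<ge> 1" by (simp add: R_def sum_nonneg)
  have bd: "cmod (coeff (red k) j) \<le> R ^ k" for k j
  proof (induction k arbitrary: j)
    case (Suc k)
    have "cmod (coeff (red (Suc k)) j)
        \<le> cmod (coeff (pCons 0 (red k)) j) + cmod (coeff (red k) d * coeff M j)"
      by (simp add: red norm_triangle_ineq4)
    also have "\<dots> \<le> R ^ k + R ^ k * (R - 1)"
    proof (rule add_mono)
      show "cmod (coeff (pCons 0 (red k)) j) \<le> R ^ k" using Suc R0 by (cases j) simp_all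
      show "cmod (coeff (red k) d * coeff M j) \<le> R ^ k * (R - 1)"
        unfolding norm_mult using Suc R1 R0 by (intro mult_mono) auto
    qed
    finally show ?case by (simp add: algebra_simps)
  qed (simp add: red coeff_1)
  have sm: "summable (\<lambda>k. a k * coeff (red k) j)" for j
  proof (rule summable_norm_cancel, rule summable_comparison_test')
    show "summable (\<lambda>k. cmod (a k) * R ^ k)" by (rule a)
    show "norm (norm (a k * coeff (red k) j)) \<le> cmod (a k) * R ^ k" if "k \<ge> 0" for k
      by (auto simp: norm_mult intro!: mult_left_mono bd)
  qed
  \<comment> \<open>\<open>p\<close> is the coefficientwise limit of the reduced partial sums
    \<open>S n\<close>, and \<open>D n\<close> is the distance still to go, up to sign.\<close>
  define p where "p = (\<Sum>j\<le>d. monom (\<Sum>k. a k * coeff (red k) j) j)"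
  define S where "S n = (\<Sum>k<n. Polynomial.smult (a k) (red k))" for n
  define D where "D n = S n - p" for n
  have cp: "coeff p j = (\<Sum>k. a k * coeff (red k) j)" for j
  proof (cases "j \<le> d")
    case True then show ?thesis by (simp add: p_def coeff_sum)
  next
    case False
    then have "coeff (red k) j = 0" for k using deg[of k] by (intro coeff_eq_0) auto
    then show ?thesis using False by (simp add: p_def coeff_sum)
  qed
  show ?thesis
  proof
    fix n
    have "(\<Sum>k<n. monom (a k) k) - p - D n = (\<Sum>k<n. Polynomial.smult (a k) (monom 1 k - red k))"
      by (simp add: D_def S_def smult_diff_right sum_subtractf smult_monom)
    moreover have "m dvd \<dots>"
      by (intro dvd_sum dvd_smult dvd_trans[OF mM dvd])
    ultimately show "m dvd (\<Sum>k<n. monom (a k) k) - p - D n" by simp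
    have "degree (S n) \<le> d" unfolding S_def
      by (intro degree_sum_le) (auto simp: deg)
    moreover have "degree p \<le> d" unfolding p_def
      by (intro degree_sum_le) (auto intro: order.trans[OF degree_monom_le])
    ultimately show "degree (D n) \<le> d" unfolding D_def by (rule degree_diff_le)
  next
    fix j
    have "(\<lambda>n. \<Sum>k<n. a k * coeff (red k) j) \<longlonglongrightarrow> coeff p j"
      unfolding cp using sm summable_LIMSEQ by blast
    then have "(\<lambda>n. (\<Sum>k<n. a k * coeff (red k) j) - coeff p j) \<longlonglongrightarrow> 0"
      by (simp add: LIM_zero_iff)
    then show "(\<lambda>n. coeff (D n) j) \<longlonglongrightarrow> 0"
      by (simp add: D_def S_def coeff_sum)
  qed
qed

section \<open>Endomorphisms of complexes and of their homology\<close>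

lemma linear_mapI:
  assumes "vectorspace CC V" "vectorspace CC W"
    and "\<And>v. v \<in> carrier V \<Longrightarrow> g v \<in> carrier W"
    and "\<And>v w. v \<in> carrier V \<Longrightarrow> w \<in> carrier V \<Longrightarrow> g (v \<oplus>\<^bsub>V\<^esub> w) = g v \<oplus>\<^bsub>W\<^esub> g w"
    and "\<And>c v. v \<in> carrier V \<Longrightarrow> g (c \<odot>\<^bsub>V\<^esub> v) = c \<odot>\<^bsub>W\<^esub> g v"
  shows "linear_map CC V W g"
  using assms
  by (auto simp: linear_map_def mod_hom_def mod_hom_axioms_def module_hom_def vectorspace_def)

lemma linear_map_cong:
  assumes g: "linear_map CC V W g" and h: "\<And>v. v \<in> carrier V \<Longrightarrow> h v = g v"
  shows "linear_map CC V W h"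
proof -
  have V: "vectorspace CC V" "vectorspace CC W" using g by (auto simp: linear_map_def)
  interpret V: vectorspace CC V by (rule V(1))
  interpret g: linear_map CC V W g by (rule g)
  show ?thesis
    by (rule linear_mapI[OF V]) (use h g.f_smult V.smult_closed in auto)
qed

lemma submodule_imp_abelian_subgroup:
  assumes V: "vectorspace CC V" and W: "submodule CC W V"
  shows "abelian_subgroup W V"
proof (rule abelian_subgroupI3)
  interpret V: vectorspace CC V by (rule V)
  interpret W: submodule CC W V by (rule W)
  show "additive_subgroup W V"
  proof (rule additive_subgroup.intro, unfold_locales)
    show "W \<subseteq> carrier (add_monoid V)" using W.subset by simp
    show "\<And>x y. x \<in> W \<Longrightarrow> y \<in> W \<Longrightarrow> x \<otimes>\<^bsub>add_monoid V\<^esub> y \<in> W" by simp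
    show "\<one>\<^bsub>add_monoid V\<^esub> \<in> W" by simp
    fix x assume x: "x \<in> W"
    then have "x \<in> carrier V" using W.subset by auto
    then have "\<ominus>\<^bsub>V\<^esub> x \<in> W"
      using W.smult_closed[of "\<ominus>\<^bsub>CC\<^esub> \<one>\<^bsub>CC\<^esub>", OF _ x] V.smult_minus_1 by simp
    then show "inv\<^bsub>add_monoid V\<^esub> x \<in> W" by (simp add: a_inv_def)
  qed
  show "abelian_group V" by unfold_locales
qed

lemma carrier_quotient_space:
  "carrier (quotient_space V W) = (\<lambda>x. W +>\<^bsub>V\<^esub> x) ` carrier V"
  unfolding quotient_space_def A_RCOSETS_def' by auto

text \<open>Scalar multiplication on the quotient is a union over all representatives; the union
  collapses because all of them yield the same coset.\<close>

lemma linear_map_quotient: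
  assumes V: "vectorspace CC V" and W: "submodule CC W V"
  shows "linear_map CC V (quotient_space V W) (\<lambda>x. W +>\<^bsub>V\<^esub> x)"
proof (rule linear_mapI[OF V quotient_space_vectorspace[OF V W]])
  interpret V: vectorspace CC V by (rule V)
  interpret W: submodule CC W V by (rule W)
  interpret S: abelian_subgroup W V by (rule submodule_imp_abelian_subgroup[OF V W])
  fix v assume v: "v \<in> carrier V"
  then show "W +>\<^bsub>V\<^esub> v \<in> carrier (quotient_space V W)" by (auto simp: carrier_quotient_space)
  show "W +>\<^bsub>V\<^esub> (v \<oplus>\<^bsub>V\<^esub> w) = (W +>\<^bsub>V\<^esub> v) \<oplus>\<^bsub>quotient_space V W\<^esub> (W +>\<^bsub>V\<^esub> w)"
    if "w \<in> carrier V" for w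
    using S.a_rcos_sum[OF v that] by (simp add: quotient_space_def)
  fix c
  have "W +>\<^bsub>V\<^esub> (c \<odot>\<^bsub>V\<^esub> z) = W +>\<^bsub>V\<^esub> (c \<odot>\<^bsub>V\<^esub> v)" if z: "z \<in> W +>\<^bsub>V\<^esub> v" for z
  proof -
    obtain w where w: "w \<in> W" "z = w \<oplus>\<^bsub>V\<^esub> v" using z unfolding a_r_coset_def' by auto
    then have "c \<odot>\<^bsub>V\<^esub> z = c \<odot>\<^bsub>V\<^esub> w \<oplus>\<^bsub>V\<^esub> c \<odot>\<^bsub>V\<^esub> v"
      using V.smult_r_distr[of c w v] W.subset v by auto
    then have "c \<odot>\<^bsub>V\<^esub> z \<in> W +>\<^bsub>V\<^esub> (c \<odot>\<^bsub>V\<^esub> v)"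
      using W.smult_closed[of c w] w unfolding a_r_coset_def' by auto
    then show ?thesis using S.a_repr_independence' V.smult_closed v by simp
  qed
  moreover have "v \<in> W +>\<^bsub>V\<^esub> v" using S.a_rcos_self v by blast
  ultimately have "(\<Union>z\<in>W +>\<^bsub>V\<^esub> v. W +>\<^bsub>V\<^esub> (c \<odot>\<^bsub>V\<^esub> z)) = W +>\<^bsub>V\<^esub> (c \<odot>\<^bsub>V\<^esub> v)" by blast
  then show "W +>\<^bsub>V\<^esub> (c \<odot>\<^bsub>V\<^esub> v) = c \<odot>\<^bsub>quotient_space V W\<^esub> (W +>\<^bsub>V\<^esub> v)"
    by (simp add: quotient_space_def)
qed

abbreviation cycle_space :: "'v cpx \<Rightarrow> int \<Rightarrow> (complex, 'v) module" where
  "cycle_space X i \<equiv> term_at X i\<lparr>carrier := cycles X i\<rparr>"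

lemma a_r_coset_carrier_update [simp]: "W +>\<^bsub>V\<lparr>carrier := Z\<rparr>\<^esub> x = W +>\<^bsub>V\<^esub> x"
  by (simp add: a_r_coset_def')

section \<open>Chain endomorphisms, cycles and induced maps\<close>

locale complex_endomorphism =
  fixes C :: "'v cpx" and \<phi> :: "int \<Rightarrow> 'v \<Rightarrow> 'v"
  assumes complex: "chain_complex C"
    and linear: "linear_map CC (term_at C k) (term_at C k) (\<phi> k)"
    and commute: "x \<in> carrier (term_at C k) \<Longrightarrow> diff C k (\<phi> k x) = \<phi> (k - 1) (diff C k x)"
begin

lemma linear_diff: "linear_map CC (term_at C i) (term_at C (i - 1)) (diff C i)"
  using complex by (auto simp: chain_complex_def)

lemma linear_diff_Suc: "linear_map CC (term_at C (i + 1)) (term_at C i) (diff C (i + 1))"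
  using linear_diff[of "i + 1"] by simp

lemma term_vectorspace: "vectorspace CC (term_at C i)"
  using linear_diff[of i] by (simp add: linear_map_def)

lemma term_endomorphism: "vs_endomorphism (term_at C k) (\<phi> k)"
  using term_vectorspace linear by (intro vs_endomorphism.intro vs_endomorphism_axioms.intro)

lemma cycles_subset: "cycles C i \<subseteq> carrier (term_at C i)"
  by (auto simp: cycles_def)

lemma cycles_vectorspace: "vectorspace CC (cycle_space C i)"
proof -
  interpret d: linear_map CC "term_at C i" "term_at C (i - 1)" "diff C i" by (rule linear_diff)
  have "cycles C i = d.ker" unfolding cycles_def d.ker_def by simp
  then show ?thesis using d.V.subspace_is_vs[OF d.kerT_is_subspace] by simp
qed

lemma boundaries_submodule: "submodule CC (boundaries C i) (cycle_space C i)"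
proof -
  interpret e: linear_map CC "term_at C (i + 1)" "term_at C i" "diff C (i + 1)"
    by (rule linear_diff_Suc)
  interpret Z: vectorspace CC "cycle_space C i" by (rule cycles_vectorspace)
  have im: "boundaries C i = e.im" unfolding boundaries_def e.im_def by simp
  interpret B: submodule CC "boundaries C i" "term_at C i"
    unfolding im by (rule e.im_is_submodule)
  have "boundaries C i \<subseteq> cycles C i"
  proof
    fix y assume "y \<in> boundaries C i"
    then obtain x where x: "x \<in> carrier (term_at C (i + 1))" "y = diff C (i + 1) x"
      unfolding boundaries_def by auto
    have "diff C (i + 1 - 1) (diff C (i + 1) x) = \<zero>\<^bsub>term_at C (i + 1 - 2)\<^esub>"
      using complex x unfolding chain_complex_def by blast
    then show "y \<in> cycles C i" using x unfolding cycles_def by auto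
  qed
  then show ?thesis using Z.module_axioms by unfold_locales auto
qed

lemma endo_cycles: "z \<in> cycles C i \<Longrightarrow> \<phi> i z \<in> cycles C i"
proof -
  interpret f: vs_endomorphism "term_at C i" "\<phi> i" by (rule term_endomorphism)
  interpret g: vs_endomorphism "term_at C (i - 1)" "\<phi> (i - 1)" by (rule term_endomorphism)
  show "z \<in> cycles C i \<Longrightarrow> \<phi> i z \<in> cycles C i"
    using commute[of z i] by (auto simp: cycles_def)
qed

lemma endo_boundaries:
  assumes "b \<in> boundaries C i"
  shows "\<phi> i b \<in> boundaries C i"
proof -
  interpret f: vs_endomorphism "term_at C (i + 1)" "\<phi> (i + 1)" by (rule term_endomorphism)
  obtain x where x: "x \<in> carrier (term_at C (i + 1))" "b = diff C (i + 1) x"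
    using assms by (auto simp: boundaries_def)
  then show ?thesis
    using commute[OF x(1)] unfolding boundaries_def by (auto intro!: image_eqI[of _ _ "\<phi> (i + 1) x"])
qed

lemma cycles_endomorphism: "vs_endomorphism (cycle_space C i) (\<phi> i)"
proof (intro vs_endomorphism.intro vs_endomorphism_axioms.intro cycles_vectorspace linear_mapI)
  show "\<phi> i v \<in> carrier (cycle_space C i)" if "v \<in> carrier (cycle_space C i)" for v
    using that endo_cycles by simp
qed (use cycles_subset in \<open>auto simp: vs_endomorphism.endo_add[OF term_endomorphism]
      vs_endomorphism.endo_smult[OF term_endomorphism] subset_iff\<close>)

lemma carrier_homology:
  "carrier (homology i C) = (\<lambda>z. boundaries C i +>\<^bsub>term_at C i\<^esub> z) ` cycles C i"
  by (simp add: homology_def carrier_quotient_space)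

lemma linear_map_homology_class:
  "linear_map CC (cycle_space C i) (homology i C) (\<lambda>z. boundaries C i +>\<^bsub>term_at C i\<^esub> z)"
  using linear_map_quotient[OF cycles_vectorspace boundaries_submodule, of i]
  by (simp add: homology_def)

text \<open>The induced map is a union over representatives. They differ by boundaries, which a
  chain map preserves, so all of them contribute one coset.\<close>

lemma homology_map_class:
  assumes z: "z \<in> cycles C i"
  shows "homology_map i C \<phi> (boundaries C i +>\<^bsub>term_at C i\<^esub> z) = boundaries C i +>\<^bsub>term_at C i\<^esub> \<phi> i z"
proof -
  interpret S: abelian_subgroup "boundaries C i" "cycle_space C i"
    by (rule submodule_imp_abelian_subgroup[OF cycles_vectorspace boundaries_submodule])
  interpret f: vs_endomorphism "cycle_space C i" "\<phi> i" by (rule cycles_endomorphism)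
  have "boundaries C i +>\<^bsub>term_at C i\<^esub> \<phi> i x = boundaries C i +>\<^bsub>term_at C i\<^esub> \<phi> i z"
    if x: "x \<in> boundaries C i +>\<^bsub>term_at C i\<^esub> z" for x
  proof -
    obtain b where b: "b \<in> boundaries C i" "x = b \<oplus>\<^bsub>term_at C i\<^esub> z"
      using x by (auto simp: a_r_coset_def')
    then have "b \<in> cycles C i" using S.a_subset by auto
    then have "\<phi> i x = \<phi> i b \<oplus>\<^bsub>term_at C i\<^esub> \<phi> i z"
      using f.endo_add[of b z] z b by simp
    then have "\<phi> i x \<in> boundaries C i +>\<^bsub>term_at C i\<^esub> \<phi> i z"
      using endo_boundaries[OF b(1)] by (auto simp: a_r_coset_def')
    then show ?thesis
      using S.a_repr_independence'[of "\<phi> i x" "\<phi> i z"] endo_cycles[OF z] by simp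
  qed
  moreover have "z \<in> boundaries C i +>\<^bsub>term_at C i\<^esub> z" using S.a_rcos_self[of z] z by simp
  ultimately show ?thesis unfolding homology_map_def by blast
qed

text \<open>Linearity descends from the cycles, since every homology class has a representative
  cycle.\<close>

lemma homology_endomorphism: "vs_endomorphism (homology i C) (homology_map i C \<phi>)"
proof (intro vs_endomorphism.intro vs_endomorphism_axioms.intro homology_vectorspace complex linear_mapI)
  interpret Z: vectorspace CC "cycle_space C i" by (rule cycles_vectorspace)
  interpret p: linear_map CC "cycle_space C i" "homology i C" "\<lambda>z. boundaries C i +>\<^bsub>term_at C i\<^esub> z"
    by (rule linear_map_homology_class)
  interpret f: vs_endomorphism "cycle_space C i" "\<phi> i" by (rule cycles_endomorphism)
  fix v assume "v \<in> carrier (homology i C)"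
  then obtain x where x: "x \<in> cycles C i" "v = boundaries C i +>\<^bsub>term_at C i\<^esub> x"
    by (auto simp: carrier_homology)
  show "homology_map i C \<phi> v \<in> carrier (homology i C)"
    using x homology_map_class endo_cycles by (auto simp: carrier_homology)
  show "homology_map i C \<phi> (c \<odot>\<^bsub>homology i C\<^esub> v) = c \<odot>\<^bsub>homology i C\<^esub> homology_map i C \<phi> v" for c
    using x p.f_smult[of c x] p.f_smult[of c "\<phi> i x"] f.endo_smult[of x c] f.smult_closed'[of x c]
      homology_map_class[OF x(1)] homology_map_class[of "c \<odot>\<^bsub>term_at C i\<^esub> x" i] endo_cycles[OF x(1)] by simp
  fix w assume "w \<in> carrier (homology i C)"
  then obtain y where y: "y \<in> cycles C i" "w = boundaries C i +>\<^bsub>term_at C i\<^esub> y"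
    by (auto simp: carrier_homology)
  have "homology_map i C \<phi> (v \<oplus>\<^bsub>homology i C\<^esub> w)
      = homology_map i C \<phi> (boundaries C i +>\<^bsub>term_at C i\<^esub> (x \<oplus>\<^bsub>term_at C i\<^esub> y))"
    using p.f_add[of x y] x y by simp
  also have "\<dots> = boundaries C i +>\<^bsub>term_at C i\<^esub> (\<phi> i x \<oplus>\<^bsub>term_at C i\<^esub> \<phi> i y)"
    using homology_map_class[of "x \<oplus>\<^bsub>term_at C i\<^esub> y" i] Z.a_closed[of x y] f.endo_add[of x y] x(1) y(1)
    by simp
  also have "\<dots> = homology_map i C \<phi> v \<oplus>\<^bsub>homology i C\<^esub> homology_map i C \<phi> w"
    using p.f_add[of "\<phi> i x" "\<phi> i y"] endo_cycles x y by (simp add: homology_map_class)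
  finally show "homology_map i C \<phi> (v \<oplus>\<^bsub>homology i C\<^esub> w)
      = homology_map i C \<phi> v \<oplus>\<^bsub>homology i C\<^esub> homology_map i C \<phi> w" .
qed

text \<open>Agreement on the carriers is assumed instead of equality so that \<psi> may be the
  extensional restriction of \<open>p(\<phi>)\<close>.\<close>

lemma complex_endomorphism_poly_act:
  assumes \<psi>: "\<And>k x. x \<in> carrier (term_at C k) \<Longrightarrow> \<psi> k x = poly_act (term_at C k) (\<phi> k) p x"
  shows "complex_endomorphism C \<psi>"
proof (rule complex_endomorphism.intro[OF complex])
  fix k
  have "linear_map CC (term_at C k) (term_at C k) (poly_act (term_at C k) (\<phi> k) p)"
    by (rule vs_endomorphism.linear_map_poly_act[OF term_endomorphism])
  then show "linear_map CC (term_at C k) (term_at C k) (\<psi> k)"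
    by (rule linear_map_cong) (rule \<psi>)
next
  fix k x assume x: "x \<in> carrier (term_at C k)"
  have "diff C k x \<in> carrier (term_at C (k - 1))"
    using linear_diff[of k] x by (auto simp: linear_map_def mod_hom_def mod_hom_axioms_def module_hom_def)
  moreover have "diff C k (poly_act (term_at C k) (\<phi> k) p x)
      = poly_act (term_at C (k - 1)) (\<phi> (k - 1)) p (diff C k x)"
    by (rule poly_act_commute[OF term_endomorphism term_endomorphism linear_diff _ x]) (rule commute)
  ultimately show "diff C k (\<psi> k x) = \<psi> (k - 1) (diff C k x)"
    using \<psi>[OF x] \<psi>[of "diff C k x" "k - 1"] by metis
qed

text \<open>The projection from cycles to classes intertwines \<phi> with its induced map, so
  \<open>poly_act_commute\<close> applies.\<close>

lemma homology_map_poly_act: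
  assumes \<psi>: "\<And>k x. x \<in> carrier (term_at C k) \<Longrightarrow> \<psi> k x = poly_act (term_at C k) (\<phi> k) p x"
    and v: "v \<in> carrier (homology i C)"
  shows "homology_map i C \<psi> v = poly_act (homology i C) (homology_map i C \<phi>) p v"
proof -
  interpret \<psi>: complex_endomorphism C \<psi> by (rule complex_endomorphism_poly_act[OF \<psi>])
  obtain z where z: "z \<in> cycles C i" "v = boundaries C i +>\<^bsub>term_at C i\<^esub> z"
    using v by (auto simp: carrier_homology)
  have "homology_map i C \<psi> v = boundaries C i +>\<^bsub>term_at C i\<^esub> poly_act (cycle_space C i) (\<phi> i) p z"
    using z \<psi>.homology_map_class[OF z(1)] \<psi>[of z i] cycles_subset[of i] by (simp add: subset_iff)
  also have "\<dots> = poly_act (homology i C) (homology_map i C \<phi>) p v"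
    unfolding z(2)
    by (rule poly_act_commute[OF cycles_endomorphism homology_endomorphism linear_map_homology_class])
      (use z homology_map_class in auto)
  finally show ?thesis .
qed

text \<open>Multiply the annihilators of the degrees from \<open>-b\<close> to \<open>b\<close>. In
  all other degrees homology is zero, so any polynomial annihilates.\<close>

lemma ex_annihilating_poly_homology:
  assumes b: "bounded_complex C" and fd: "\<And>i. vectorspace.fin_dim CC (homology i C)"
  shows "\<exists>m. m \<noteq> 0 \<and>
    (\<forall>i. \<forall>v\<in>carrier (homology i C). poly_act (homology i C) (homology_map i C \<phi>) m v = \<zero>\<^bsub>homology i C\<^esub>)"
proof -
  obtain b where b: "\<And>i. b < \<bar>i\<bar> \<Longrightarrow> carrier (term_at C i) = {\<zero>\<^bsub>term_at C i\<^esub>}"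
    using assms(1) by (auto simp: bounded_complex_def)
  obtain M where M: "\<And>i. M i \<noteq> 0 \<and>
    (\<forall>v\<in>carrier (homology i C). poly_act (homology i C) (homology_map i C \<phi>) (M i) v = \<zero>\<^bsub>homology i C\<^esub>)"
    using vs_endomorphism.ex_annihilating_poly[OF homology_endomorphism fd] by metis
  define m where "m = (\<Prod>i\<in>{-b..b}. M i)"
  have "poly_act (homology i C) (homology_map i C \<phi>) m v = \<zero>\<^bsub>homology i C\<^esub>"
    if v: "v \<in> carrier (homology i C)" for i v
  proof -
    interpret h: vs_endomorphism "homology i C" "homology_map i C \<phi>" by (rule homology_endomorphism)
    show ?thesis
    proof (cases "\<bar>i\<bar> \<le> b")
      case True
      then have "M i dvd m" unfolding m_def by (intro dvd_prodI) auto
      then show ?thesis using h.poly_act_dvd[OF v] M v by blast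
    next
      case False
      then have "cycles C i \<subseteq> {\<zero>\<^bsub>term_at C i\<^esub>}" using b cycles_subset by fastforce
      then have "carrier (homology i C) \<subseteq> {boundaries C i +>\<^bsub>term_at C i\<^esub> \<zero>\<^bsub>term_at C i\<^esub>}"
        by (auto simp: carrier_homology)
      then show ?thesis using h.poly_act_closed[OF v, of m] h.zero_closed by blast
    qed
  qed
  moreover have "m \<noteq> 0" using M by (simp add: m_def)
  ultimately show ?thesis by blast
qed

end

section \<open>Perfect complexes and the endomorphism \<open>f(T)\<close>\<close>

lemma Perf_object:
  assumes X: "X \<in> simplices Perf 0"
  shows "chain_complex (complex_of X)" "bounded_complex (complex_of X)"
    "\<And>i. vectorspace.fin_dim CC (homology i (complex_of X))"
proof -
  \<comment> \<open>\<open>Perf\<close> imposes its conditions on vertices; a 0-simplex is its own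
    vertex, so they hold for \<open>X\<close> itself.\<close>
  have "vertex derived_category 0 X = X"
    using X unfolding Perf_def full_subcategory_def derived_category_def dg_simplices_def
    by (auto simp: vertex_def dg_act_def nerve_index_0 PiE_def extensional_def fun_eq_iff)
  then have "X \<in> simplices derived_category 0 \<and> bounded_complex (complex_of X) \<and>
        (\<forall>i. vectorspace.fin_dim CC (homology i (complex_of X)))"
    using X unfolding Perf_def full_subcategory_def by auto
  then show "chain_complex (complex_of X)" "bounded_complex (complex_of X)"
    "\<And>i. vectorspace.fin_dim CC (homology i (complex_of X))"
    by (auto simp: derived_category_def dg_simplices_def PiE_def Pi_def)
qed

theorem theorem6p8:
  fixes X T :: "'v dg_simplex" and f :: "complex \<Rightarrow> complex"
  assumes "X \<in> simplices Perf 0"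
    and "T \<in> End Perf X"
    and "f holomorphic_on UNIV"
  shows "\<exists>fT\<in>End Perf X. \<forall>i::int.
           functional_calculus (H_obj i X) f (H_map i T) (H_map i fT)"
proof -
  define C where "C = complex_of X"
  note C = Perf_object[OF assms(1), folded C_def]
  obtain \<phi> where \<phi>: "T = (\<lambda>i\<in>{..1}. C, \<lambda>I\<in>{{0, 1}}. \<phi>)"
    "\<And>k. linear_map CC (term_at C k) (term_at C k) (\<phi> k)"
    "\<And>k x. x \<in> carrier (term_at C k) \<Longrightarrow> diff C k (\<phi> k x) = \<phi> (k - 1) (diff C k x)"
    using assms(2) unfolding End_Perf_iff[OF assms(1)] C_def by blast
  interpret complex_endomorphism C \<phi>
    by (rule complex_endomorphism.intro[OF C(1) \<phi>(2,3)])
  \<comment> \<open>\<open>m\<close>, and with it \<open>p\<close> and \<open>D\<close>, is chosen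
    before the degree \<open>i\<close>, so a single chain map serves every homology group.\<close>
  obtain m where m: "m \<noteq> 0" "\<And>i v. v \<in> carrier (homology i C) \<Longrightarrow>
      poly_act (homology i C) (homology_map i C \<phi>) m v = \<zero>\<^bsub>homology i C\<^esub>"
    using ex_annihilating_poly_homology[OF C(2,3)] by blast
  obtain p D d where D: "\<And>n. m dvd (\<Sum>k<n. monom (taylor_coeff f k) k) - p - D n"
    "\<And>n. degree (D n) \<le> d" "\<And>j. (\<lambda>n. coeff (D n) j) \<longlonglongrightarrow> 0"
    using power_series_mod_poly[OF entire_taylor_abs_summable[OF assms(3)] m(1)] by blast
  \<comment> \<open>Components of a simplex are extensional, hence the restriction of
    \<open>p(\<phi>)\<close> to the carriers.\<close>
  define \<psi> where "\<psi> k = (\<lambda>x\<in>carrier (term_at C k). poly_act (term_at C k) (\<phi> k) p x)" for k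
  have \<psi>: "\<psi> k x = poly_act (term_at C k) (\<phi> k) p x" if "x \<in> carrier (term_at C k)" for k x
    using that by (simp add: \<psi>_def)
  interpret \<psi>: complex_endomorphism C \<psi> by (rule complex_endomorphism_poly_act[OF \<psi>])
  define fT :: "'v dg_simplex" where "fT = (\<lambda>i\<in>{..1}. C, \<lambda>I\<in>{{0, 1}}. \<psi>)"
  have "fT \<in> End Perf X"
    unfolding End_Perf_iff[OF assms(1)] C_def[symmetric]
    using \<psi>.linear \<psi>.commute by (intro exI[of _ \<psi>]) (auto simp: fT_def \<psi>_def)
  moreover have "functional_calculus (H_obj i X) f (H_map i T) (H_map i fT)" for i
  proof -
    interpret h: vs_endomorphism "homology i C" "homology_map i C \<phi>" by (rule homology_endomorphism)
    interpret h': vs_endomorphism "homology i C" "homology_map i C \<psi>" by (rule \<psi>.homology_endomorphism)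
    \<comment> \<open>The series for \<open>H_i(T)\<close> converges to \<open>p(H_i(T))\<close>,
      which \<open>homology_map_poly_act\<close> identifies with the map induced by \<psi>.\<close>
    have "functional_calculus (homology i C) f (homology_map i C \<phi>) (homology_map i C \<psi>)"
      by (rule h.functional_calculus_poly_act[OF C(3) m(2) D h'.linear homology_map_poly_act[OF \<psi>]])
    then show ?thesis
      by (simp add: H_obj_def H_map_def C_def[symmetric] \<phi>(1) fT_def)
  qed
  ultimately show ?thesis by blast
qed

end
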